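(* Let $P$ be a smooth $(n+1)$-dimensional lattice polytope. For every integer $d\ge1$, let $K(d)$ be a random primitive triangulation of $dP$ following an arbitrary distribution, let $\varepsilon:dP\cap M\to\mathbb F_2$ be a sign distribution chosen uniformly at random and independently of $K(d)$, and let $\mathbb RX_\varepsilon(d)$ be the T-hypersurface associated to $(K(d),\varepsilon)$. Then $$\mathbb E\big[b_0(\mathbb RX_\varepsilon(d))\big]=\Theta(d^{n+1}),$$ i.e. as a function of $d$ it is eventually bounded above and below by positive multiples of $d^{n+1}$.
   Context: $M,N$ are dual lattices of rank $n+1$, $n\ge1$, with pairing $\langle-,-\rangle$; $N_2=N\otimes\mathbb F_2$. A full-dimensional lattice polytope $P\subset M\otimes\mathbb R$ is smooth if it is simple and at each vertex the primitive edge directions form a basis of $M$. A primitive triangulation of a lattice polytope is a triangulation into lattice simplices whose maximal simplices have volume $1/(n+1)!$ (unit volume = parallelepiped on a basis of $M$); its vertices are exactly the lattice points of the polytope. $b_0(Z)=\dim H_0(Z;\mathbb F_2)$ is the number of connected components of $Z$. T-hypersurface. Let $K$ be a primitive triangulation of a smooth polytope $P'$ (here $P'=dP$) and $\varepsilon:P'\cap M\to\mathbb F_2$. For a face $Q$ of $P'$ put $\mathrm{Sed}(Q)=(TQ^\perp\cap N)\otimes\mathbb F_2$, where $TQ$ is the linear tangent space of $Q$. The real locus $\mathcal Y(\mathbb R)$ of the toric variety of $P'$ is the quotient of $N_2\times P'$ by $(u,x)\sim(u',x)$ iff $u-u'\in\mathrm{Sed}(Q_x)$, $Q_x$ the smallest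 face containing $x$; $u\cdot E$ denotes the image of $\{u\}\times E$. The dual cell $\sigma^*$ of a simplex $\sigma\in K$ is the union of all simplices of the barycentric subdivision of $K$ given by flags of simplices all containing $\sigma$. The T-hypersurface $\mathbb RX_\varepsilon\subset\mathcal Y(\mathbb R)$ is the union of the cells $u\cdot(\sigma^1)^*$ over all edges $\sigma^1$ of $K$, with vertices $v_0,v_1$, and all $u\in N_2$ such that $\langle v_0-v_1,u\rangle+\varepsilon(v_0)+\varepsilon(v_1)=1$. *)

theory Defs
  imports
    "HOL-Probability.Probability"
    "HOL-Library.Z2"
    "HOL-Library.Landau_Symbols"
begin

section \<open>Lattices and smooth polytopes\<close>

text \<open>
  A basis is chosen, so that both lattices \<open>M\<close> and \<open>N\<close> become the integer points of
  \<open>\<real>^'n\<close>, with rank \<open>CARD('n)\<close>; the pairing is the inner product, the unit volume is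
  Lebesgue measure, and \<open>N \<otimes> F\<^sub>2\<close> is \<open>bit ^ 'n\<close>.
\<close>

definition int_lattice :: "(real ^ 'n) set" where
  "int_lattice = {x. \<forall>i. x $ i \<in> \<int>}"

definition mod2 :: "real ^ 'n \<Rightarrow> bit ^ 'n" where
  "mod2 x = (\<chi> i. of_int \<lfloor>x $ i\<rfloor>)"

text \<open>The pairing of \<open>M\<close> with \<open>N \<otimes> F\<^sub>2\<close>; meaningful when \<open>x\<close> is a lattice point.\<close>

definition pair2 :: "real ^ 'n \<Rightarrow> bit ^ 'n \<Rightarrow> bit" where
  "pair2 x u = (\<Sum>i\<in>UNIV. mod2 x $ i * u $ i)"

definition lattice_basis :: "(real ^ 'n) set \<Rightarrow> bool" where
  "lattice_basis B \<longleftrightarrow> independent B \<and> range (\<lambda>c. \<Sum>b\<in>B. of_int (c b) *\<^sub>R b) = int_lattice"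

definition primitive_vector :: "real ^ 'n \<Rightarrow> bool" where
  "primitive_vector p \<longleftrightarrow> p \<in> int_lattice \<and> p \<noteq> 0 \<and>
     (\<forall>q\<in>int_lattice. \<forall>k::int. p = of_int k *\<^sub>R q \<longrightarrow> \<bar>k\<bar> = 1)"

definition lattice_polytope :: "(real ^ 'n) set \<Rightarrow> bool" where
  "lattice_polytope P \<longleftrightarrow> (\<exists>V. finite V \<and> V \<subseteq> int_lattice \<and> P = convex hull V)"

definition simple_polytope :: "(real ^ 'n) set \<Rightarrow> bool" where
  "simple_polytope P \<longleftrightarrow>
     (\<forall>v. v extreme_point_of P \<longrightarrow> card {e. e edge_of P \<and> v \<in> e} = CARD('n))"

definition primitive_edge_directions :: "(real ^ 'n) set \<Rightarrow> real ^ 'n \<Rightarrow> (real ^ 'n) set" where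
  "primitive_edge_directions P v =
     {p. primitive_vector p \<and> (\<exists>e t. e edge_of P \<and> v \<in> e \<and> t > 0 \<and> v + t *\<^sub>R p \<in> e)}"

definition smooth_polytope :: "(real ^ 'n) set \<Rightarrow> bool" where
  "smooth_polytope P \<longleftrightarrow>
     lattice_polytope P \<and> aff_dim P = int CARD('n) \<and> simple_polytope P \<and>
     (\<forall>v. v extreme_point_of P \<longrightarrow> lattice_basis (primitive_edge_directions P v))"

definition dilate :: "nat \<Rightarrow> (real ^ 'n) set \<Rightarrow> (real ^ 'n) set" where
  "dilate d P = (\<lambda>x. real d *\<^sub>R x) ` P"


section \<open>Primitive triangulations and dual cells\<close>

text \<open>
  The library's simplicial complexes contain the empty simplex (as soon as they are nonempty); it
  is not maximal and contains no edge, so it plays no role below.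
\<close>

definition primitive_triangulation :: "(real ^ 'n) set \<Rightarrow> (real ^ 'n) set set \<Rightarrow> bool" where
  "primitive_triangulation P K \<longleftrightarrow>
     simplicial_complex K \<and> \<Union>K = P \<and>
     (\<forall>\<sigma>\<in>K. \<forall>v. v extreme_point_of \<sigma> \<longrightarrow> v \<in> int_lattice) \<and>
     (\<forall>\<sigma>\<in>K. (\<forall>\<tau>\<in>K. \<sigma> \<subseteq> \<tau> \<longrightarrow> \<tau> = \<sigma>) \<longrightarrow> measure lebesgue \<sigma> = 1 / fact CARD('n))"

definition barycenter :: "(real ^ 'n) set \<Rightarrow> real ^ 'n" where
  "barycenter \<sigma> =
     (1 / real (card {v. v extreme_point_of \<sigma>})) *\<^sub>R (\<Sum>v | v extreme_point_of \<sigma>. v)"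

text \<open>
  A flag is a subset of \<open>K\<close> totally ordered by inclusion; the corresponding simplex of the
  barycentric subdivision is the convex hull of the barycenters of its members.
\<close>

definition dual_cell :: "(real ^ 'n) set set \<Rightarrow> (real ^ 'n) set \<Rightarrow> (real ^ 'n) set" where
  "dual_cell K \<sigma> =
     \<Union>{convex hull (barycenter ` F) | F. subset.chain K F \<and> (\<forall>\<tau>\<in>F. \<sigma> \<subseteq> \<tau>)}"


section \<open>The real locus of the toric variety\<close>

definition tangent_space :: "(real ^ 'n) set \<Rightarrow> (real ^ 'n) set" where
  "tangent_space Q = span {x - y | x y. x \<in> Q \<and> y \<in> Q}"

text \<open>
  Since \<open>TQ\<^sup>\<bottom> \<inter> N\<close> is saturated in \<open>N\<close>, its tensor product with \<open>F\<^sub>2\<close>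
  is its image under reduction modulo 2.
\<close>

definition sed :: "(real ^ 'n) set \<Rightarrow> (bit ^ 'n) set" where
  "sed Q = mod2 ` (orthogonal_comp (tangent_space Q) \<inter> int_lattice)"

definition smallest_face :: "(real ^ 'n) set \<Rightarrow> real ^ 'n \<Rightarrow> (real ^ 'n) set" where
  "smallest_face P x = \<Inter>{Q. Q face_of P \<and> x \<in> Q}"

definition locus_rel ::
  "(real ^ 'n) set \<Rightarrow> (((bit ^ 'n) \<times> (real ^ 'n)) \<times> ((bit ^ 'n) \<times> (real ^ 'n))) set" where
  "locus_rel P =
     {((u, x), (u', x')). x \<in> P \<and> x' = x \<and> u - u' \<in> sed (smallest_face P x)}"

definition locus_proj ::
  "(real ^ 'n) set \<Rightarrow> (bit ^ 'n) \<times> (real ^ 'n) \<Rightarrow> ((bit ^ 'n) \<times> (real ^ 'n)) set" where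
  "locus_proj P z = locus_rel P `` {z}"

definition quotient_topology :: "'a topology \<Rightarrow> ('a \<Rightarrow> 'b) \<Rightarrow> 'b topology" where
  "quotient_topology X f =
     topology (\<lambda>U. U \<subseteq> f ` topspace X \<and> openin X {x \<in> topspace X. f x \<in> U})"

lemma openin_quotient_topology:
  "openin (quotient_topology X f) U \<longleftrightarrow>
     U \<subseteq> f ` topspace X \<and> openin X {x \<in> topspace X. f x \<in> U}"
proof -
  have "istopology (\<lambda>U. U \<subseteq> f ` topspace X \<and> openin X {x \<in> topspace X. f x \<in> U})"
    unfolding istopology_def
  proof (intro conjI allI impI; (elim conjE)?)
    fix S T
    assume "openin X {x \<in> topspace X. f x \<in> S}" "openin X {x \<in> topspace X. f x \<in> T}"
    moreover have "{x \<in> topspace X. f x \<in> S \<inter> T} =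
        {x \<in> topspace X. f x \<in> S} \<inter> {x \<in> topspace X. f x \<in> T}" by auto
    ultimately show "openin X {x \<in> topspace X. f x \<in> S \<inter> T}" by auto
  next
    fix \<K>
    assume *: "\<forall>K\<in>\<K>. K \<subseteq> f ` topspace X \<and> openin X {x \<in> topspace X. f x \<in> K}"
    have "{x \<in> topspace X. f x \<in> \<Union>\<K>} = (\<Union>K\<in>\<K>. {x \<in> topspace X. f x \<in> K})" by auto
    then show "openin X {x \<in> topspace X. f x \<in> \<Union>\<K>}" using * by auto
    show "\<Union>\<K> \<subseteq> f ` topspace X" using * by blast
  qed auto
  then show ?thesis
    by (simp add: quotient_topology_def topology_inverse')
qed

lemma quotient_map_quotient_topology: "quotient_map X (quotient_topology X f) f"
proof -
  have "{x \<in> topspace X. f x \<in> f ` topspace X} = topspace X" by auto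
  then have "openin (quotient_topology X f) (f ` topspace X)"
    by (simp add: openin_quotient_topology)
  then have "topspace (quotient_topology X f) = f ` topspace X"
    by (metis openin_quotient_topology openin_subset openin_topspace subset_antisym)
  then show ?thesis
    by (auto simp: quotient_map_def openin_quotient_topology)
qed

definition real_locus :: "(real ^ 'n) set \<Rightarrow> (((bit ^ 'n) \<times> (real ^ 'n)) set) topology" where
  "real_locus P =
     quotient_topology (prod_topology (discrete_topology UNIV) (top_of_set P)) (locus_proj P)"


section \<open>Random T-hypersurfaces\<close>

text \<open>The edges of \<open>K\<close> are its segments \<open>closed_segment v0 v1\<close> with \<open>v0 \<noteq> v1\<close>.\<close>

definition T_hypersurface ::
  "(real ^ 'n) set \<Rightarrow> (real ^ 'n) set set \<Rightarrow> (real ^ 'n \<Rightarrow> bit) \<Rightarrow> ((bit ^ 'n) \<times> (real ^ 'n)) set set" where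
  "T_hypersurface P K \<epsilon> =
     \<Union>{locus_proj P ` ({u} \<times> dual_cell K (closed_segment v0 v1)) | u v0 v1.
         v0 \<noteq> v1 \<and> closed_segment v0 v1 \<in> K \<and> pair2 (v0 - v1) u + \<epsilon> v0 + \<epsilon> v1 = 1}"

text \<open>
  T-hypersurfaces are finite unions of images of compact polyhedra; so they have finitely many
  connected components, and their number is the dimension of \<open>H\<^sub>0\<close> over \<open>F\<^sub>2\<close>.
\<close>

definition b0 :: "'a topology \<Rightarrow> nat" where
  "b0 X = card (connected_components_of X)"

definition b0_T_hypersurface ::
  "(real ^ 'n) set \<Rightarrow> (real ^ 'n) set set \<Rightarrow> (real ^ 'n \<Rightarrow> bit) \<Rightarrow> nat" where
  "b0_T_hypersurface P K \<epsilon> = b0 (subtopology (real_locus P) (T_hypersurface P K \<epsilon>))"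

text \<open>
  Sign distributions on \<open>P \<inter> M\<close> are represented by functions that take the default value
  \<open>undefined\<close> outside this finite set, so that the uniform distribution makes sense.
\<close>

definition uniform_signs :: "(real ^ 'n) set \<Rightarrow> (real ^ 'n \<Rightarrow> bit) pmf" where
  "uniform_signs P = pmf_of_set ((P \<inter> int_lattice) \<rightarrow>\<^sub>E UNIV)"

text \<open>
  As \<open>P\<close> has only finitely many primitive triangulations, a distribution on them is a
  probability mass function \<open>\<kappa>\<close>. Independence of the triangulation and the signs means that
  their joint law is the product law.
\<close>

definition expected_b0 :: "(real ^ 'n) set \<Rightarrow> (real ^ 'n) set set pmf \<Rightarrow> real" where
  "expected_b0 P \<kappa> =
     measure_pmf.expectation (pair_pmf \<kappa> (uniform_signs P))
       (\<lambda>(K, \<epsilon>). real (b0_T_hypersurface P K \<epsilon>))"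

end

theory Submission
  imports Defs
begin

text \<open>
  Throughout, \<open>N = CARD('n) = n + 1\<close>, and the maximal simplices of a triangulation are its facets.

  A primitive triangulation of \<open>dP\<close> has exactly \<open>N! vol(P) d\<^sup>N\<close> facets, whatever the
  triangulation is: they overlap in null sets and each has volume \<open>1/N!\<close>. Everything else is
  counted against this number.

  Upper bound, valid for all signs. Each cell \<open>u \<cdot> (\<sigma>\<^sup>1)\<^sup>*\<close> is connected, being a union of
  convex sets through the barycenter of \<open>\<sigma>\<^sup>1\<close>, and contains the point \<open>(u, barycenter of \<tau>)\<close>
  for any facet \<open>\<tau>\<close> above \<open>\<sigma>\<^sup>1\<close>. So every connected component contains one of the
  \<open>2\<^sup>N\<close> times (number of facets) points of this kind (\<open>b0_le_facets\<close>).

  Lower bound. Let \<open>v\<close> be a lattice point in the interior of \<open>dP\<close> with sign 1 such that all its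
  neighbours in the triangulation have sign 0. In the copy of \<open>dP\<close> labelled by \<open>u = 0\<close>, where an
  edge carries a cell exactly if its ends have different signs, the edges at \<open>v\<close> all carry cells,
  and no other edge in the star of \<open>v\<close> does. Hence the hypersurface meets the open star of \<open>v\<close>
  in the dual sphere around \<open>v\<close>. The open star is open in the real locus, because no points
  are identified over the interior of \<open>dP\<close>, and the sphere is compact. So the sphere is open and
  closed in the hypersurface, and different such \<open>v\<close> have disjoint spheres: the number of
  components is at least the number of such \<open>v\<close> (\<open>isolated_le_b0\<close>).

  A lattice point \<open>v\<close> lying on \<open>t(v)\<close> facets is of this kind with probability at least
  \<open>1/2\<close> to the power \<open>(N + 1) t(v)\<close>, as its star has at most \<open>(N + 1) t(v)\<close> vertices. The sum of \<open>t(v)\<close> over all \<open>v\<close> is at most \<open>N + 1\<close> times the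
  number of facets, so it is \<open>O(d\<^sup>N)\<close>, whereas \<open>dP\<close> has at least \<open>c d\<^sup>N\<close> interior lattice
  points. The average of \<open>t(v)\<close> is therefore bounded, and the expected number of isolated points
  is at least a positive multiple of \<open>d\<^sup>N\<close> (\<open>expectation_ge\<close>). This uses that all lattice
  points of \<open>dP\<close> are vertices of the triangulation: a lattice simplex of volume \<open>1/N!\<close> has
  determinant \<open>\<plusminus>1\<close>, so by Cramer's rule the barycentric coordinates of its lattice points are
  integers (\<open>int_point_of_unimodular_simplex\<close>).
\<close>

section \<open>Lattice points of unimodular simplices\<close>

text \<open>
  A renaming of the coordinates sends boxes to boxes of the same volume, and Lebesgue measure is
  determined by its values on boxes.
\<close>

lemma measure_reindex:
  fixes p :: "'n::finite \<Rightarrow> 'm::finite" and S :: "(real ^ 'm) set"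
  assumes p: "bij p" and S: "compact S"
  shows "measure lebesgue ((\<lambda>y. \<chi> i. y $ p i) ` S) = measure lebesgue S"
proof -
  let ?r = "\<lambda>y :: real ^ 'm. \<chi> i. y $ p i"
  let ?q = "inv p"
  have pq [simp]: "p (?q j) = j" for j using p by (simp add: bij_is_surj surj_f_inv_f)
  have qp [simp]: "?q (p j) = j" for j using p by (simp add: bij_is_inj)
  have lin: "linear ?r" by (rule linearI) (simp_all add: vec_eq_iff)
  then have cont: "continuous_on UNIV ?r"
    using linear_continuous_on linear_conv_bounded_linear by blast
  have inj: "inj ?r"
    by (rule injI) (metis pq vec_eq_iff vec_lambda_beta)
  have meas: "?r \<in> borel_measurable lborel"
    using cont by (simp add: borel_measurable_continuous_onI)
  have "lborel = distr lborel borel ?r"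
  proof (rule lborel_eqI)
    fix l u :: "real ^ 'n"
    assume le: "\<And>b. b \<in> Basis \<Longrightarrow> l \<bullet> b \<le> u \<bullet> b"
    then have le': "l $ i \<le> u $ i" for i
      using le[of "axis i 1"] by (simp add: inner_axis)
    have "?r -` box l u = box (\<chi> j. l $ ?q j) (\<chi> j. u $ ?q j)"
      by (auto simp: mem_box_cart) (metis qp pq)+
    moreover have "emeasure lborel (box (\<chi> j. l $ ?q j) (\<chi> j. u $ ?q j))
        = (\<Prod>b\<in>Basis. ((\<chi> j. u $ ?q j) - (\<chi> j. l $ ?q j)) \<bullet> b)"
      by (rule emeasure_lborel_box) (auto simp: Basis_vec_def inner_axis le')
    moreover have "(\<Prod>b\<in>Basis. ((\<chi> j. u $ ?q j) - (\<chi> j. l $ ?q j)) \<bullet> b)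
        = (\<Prod>j\<in>UNIV. u $ ?q j - l $ ?q j)"
      by (simp add: Basis_vec_def UNION_singleton_eq_range prod.reindex inj_on_def axis_eq_axis inner_axis)
    moreover have "\<dots> = (\<Prod>i\<in>UNIV. u $ i - l $ i)"
      by (rule prod.reindex_bij_betw) (simp add: p bij_imp_bij_inv)
    moreover have "(\<Prod>b\<in>Basis. (u - l) \<bullet> b) = (\<Prod>i\<in>UNIV. u $ i - l $ i)"
      by (simp add: Basis_vec_def UNION_singleton_eq_range prod.reindex inj_on_def axis_eq_axis inner_axis)
    ultimately show "emeasure (distr lborel borel ?r) (box l u) = (\<Prod>b\<in>Basis. (u - l) \<bullet> b)"
      using meas by (simp add: emeasure_distr)
  qed simp
  then have "measure lborel (?r ` S) = measure (distr lborel borel ?r) (?r ` S)"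
    by metis
  moreover have comp: "compact (?r ` S)"
    using compact_continuous_image[OF continuous_on_subset[OF cont] S] by simp
  moreover have "?r -` (?r ` S) = S"
    using inj by (simp add: inj_vimage_image_eq)
  ultimately have "measure lborel (?r ` S) = measure lborel S"
    using meas by (simp add: measure_distr borel_compact)
  then show ?thesis
    using S comp by (simp add: measure_completion borel_compact)
qed

text \<open>
  The determinant formula for the volume of a simplex lives over well-ordered index types. Any
  finite type has a copy with a well-order, pulled back from an injection into \<open>nat\<close>; results
  come back to the original coordinates along \<open>measure_reindex\<close>.
\<close>

typedef 'a wellordered_copy = "UNIV :: 'a set" ..

instance wellordered_copy :: (finite) finite
proof
  have "(UNIV :: 'a wellordered_copy set) = range Abs_wellordered_copy"
    by (metis Rep_wellordered_copy_inverse surj_def)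
  then show "finite (UNIV :: 'a wellordered_copy set)" by (metis finite finite_imageI)
qed

definition finite_rank :: "'a::finite \<Rightarrow> nat" where
  "finite_rank = (SOME f. inj f)"

lemma inj_finite_rank: "inj (finite_rank :: 'a::finite \<Rightarrow> nat)"
  unfolding finite_rank_def
  using finite_imp_inj_to_nat_seg[of "UNIV :: 'a set"] by (metis finite someI_ex)

instantiation wellordered_copy :: (finite) wellorder
begin

definition less_eq_wellordered_copy :: "'a wellordered_copy \<Rightarrow> 'a wellordered_copy \<Rightarrow> bool" where
  "x \<le> (y :: 'a wellordered_copy) \<longleftrightarrow> finite_rank x \<le> finite_rank y"

definition less_wellordered_copy :: "'a wellordered_copy \<Rightarrow> 'a wellordered_copy \<Rightarrow> bool" where
  "x < (y :: 'a wellordered_copy) \<longleftrightarrow> finite_rank x < finite_rank y"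

instance
proof
  fix P :: "'a wellordered_copy \<Rightarrow> bool" and a :: "'a wellordered_copy"
  assume *: "\<And>x. (\<And>y. y < x \<Longrightarrow> P y) \<Longrightarrow> P x"
  show "P a"
    by (induction a rule: measure_induct_rule[of finite_rank])
       (rule *, simp add: less_wellordered_copy_def)
qed (auto simp: less_eq_wellordered_copy_def less_wellordered_copy_def
          inj_eq[OF inj_finite_rank])

end

lemma bij_Rep_wellordered_copy: "bij Rep_wellordered_copy"
  by (metis Abs_wellordered_copy_inverse Rep_wellordered_copy_inject UNIV_I bijI' )

lemma CARD_wellordered_copy: "CARD('a::finite wellordered_copy) = CARD('a)"
  using bij_Rep_wellordered_copy by (metis bij_betw_same_card)

lemma det_in_Ints:
  fixes A :: "real ^ 'n ^ 'n"
  assumes "\<And>i j. A $ i $ j \<in> \<int>"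
  shows "det A \<in> \<int>"
  unfolding det_def using assms by (intro Ints_sum Ints_mult Ints_prod) auto

text \<open>
  Take a vertex \<open>x0\<close> as origin and let the columns of \<open>M\<close> be the edge vectors at \<open>x0\<close>. The volume
  forces \<open>det M = \<plusminus>1\<close>, so Cramer's rule expresses the barycentric coordinates of a lattice point
  as integers. In the simplex they are nonnegative with sum 1, so one of them is 1 and the others
  vanish.
\<close>

lemma int_point_of_unimodular_simplex_wo:
  fixes X :: "(real ^ 'n::{finite,wellorder}) set"
  assumes card: "card X = CARD('n) + 1"
    and X: "X \<subseteq> int_lattice"
    and vol: "measure lebesgue (convex hull X) = 1 / fact CARD('n)"
    and x: "x \<in> convex hull X" "x \<in> int_lattice"
  shows "x \<in> X"
proof -
  have fin: "finite X" using card by (simp add: card_ge_0_finite)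
  obtain x0 where x0: "x0 \<in> X" using card by fastforce
  have "card (UNIV :: ('n::_) set) = card (X - {x0})" using fin card x0 by simp
  then obtain f :: "('n::_) \<Rightarrow> real ^ ('n::_)" where f: "bij_betw f UNIV (X - {x0})"
    using fin finite_same_card_bij[of "UNIV :: ('n::_) set" "X - {x0}"] by auto
  define M :: "real ^ ('n::_) ^ ('n::_)" where "M = (\<chi> i. \<chi> j. f j $ i - x0 $ i)"
  have fX: "f j \<in> X" "f j \<noteq> x0" for j using f by (auto simp: bij_betw_def)
  have "measure lborel (convex hull X) = \<bar>det M\<bar> / fact CARD('n::_)"
    unfolding M_def by (rule content_simplex) (use fin card x0 f in auto)
  moreover have "measure lborel (convex hull X) = measure lebesgue (convex hull X)"
    using fin by (simp add: borel_compact finite_imp_compact_convex_hull measure_completion)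
  ultimately have det: "\<bar>det M\<bar> = 1" using vol by simp
  obtain u where u: "\<And>y. y \<in> X \<Longrightarrow> 0 \<le> u y" "sum u X = 1" "(\<Sum>y\<in>X. u y *\<^sub>R y) = x"
    using x(1) fin by (auto simp: convex_hull_finite)
  define c :: "real ^ ('n::_)" where "c = (\<chi> j. u (f j))"
  have sumX: "(\<Sum>y\<in>X. g y) = g x0 + (\<Sum>j\<in>UNIV. g (f j))" for g :: "real ^ ('n::_) \<Rightarrow> 'b::comm_monoid_add"
    using sum.reindex_bij_betw[OF f, of g] by (simp add: sum.remove[OF fin x0])
  have u0: "u x0 = 1 - (\<Sum>j\<in>UNIV. u (f j))" using u(2) sumX[of u] by simp
  have "M *v c = x - x0"
  proof -
    have "x - x0 = u x0 *\<^sub>R x0 + (\<Sum>j\<in>UNIV. u (f j) *\<^sub>R f j) - x0"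
      using u(3) sumX[of "\<lambda>y. u y *\<^sub>R y"] by simp
    also have "\<dots> = (\<Sum>j\<in>UNIV. u (f j) *\<^sub>R (f j - x0))"
      by (simp add: u0 scaleR_right_diff_distrib sum_subtractf scaleR_left_diff_distrib scaleR_sum_left)
    also have "\<dots> = M *v c"
      by (simp add: vec_eq_iff matrix_vector_mult_def M_def c_def mult.commute)
    finally show ?thesis by simp
  qed
  then have c: "c = (\<chi> k. det (\<chi> i j. if j = k then (x - x0) $ i else M $ i $ j) / det M)"
    using det cramer[of M c "x - x0"] by force
  have Xint: "y $ i \<in> \<int>" if "y \<in> X" for y i using X that by (auto simp: int_lattice_def)
  have int: "u (f k) \<in> \<int>" for k
  proof -
    have "det (\<chi> i j. if j = k then (x - x0) $ i else M $ i $ j) \<in> \<int>"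
      using Xint x0 fX x(2) by (intro det_in_Ints) (auto simp: M_def int_lattice_def)
    then have "det (\<chi> i j. if j = k then (x - x0) $ i else M $ i $ j) / det M \<in> \<int>"
      using det by (auto simp: abs_if split: if_splits)
    then show ?thesis using c by (simp add: c_def vec_eq_iff)
  qed
  then have "u x0 \<in> \<int>" unfolding u0 by (intro Ints_diff Ints_sum) auto
  with int have intX: "u y \<in> \<int>" if "y \<in> X" for y
  proof (cases "y = x0")
    case False
    then have "y \<in> range f" using that f by (simp add: bij_betw_def)
    then show ?thesis using int by auto
  qed (use \<open>u x0 \<in> \<int>\<close> in simp)
  \<comment> \<open>The coordinates are nonnegative integers with sum 1.\<close>
  obtain y where y: "y \<in> X" "u y \<noteq> 0" using u(2) by (metis sum.neutral zero_neq_one)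
  have "1 \<le> u y" using intX[OF y(1)] u(1)[OF y(1)] y(2)
    by (metis Ints_nonzero_abs_ge1 abs_of_nonneg)
  moreover have "sum u X = u y + sum u (X - {y})" using fin y(1) by (simp add: sum.remove)
  moreover have "0 \<le> sum u (X - {y})" using u(1) by (intro sum_nonneg) auto
  ultimately have "u y = 1" "sum u (X - {y}) = 0" using u(2) by auto
  then have "u z = 0" if "z \<in> X - {y}" for z
    using that u(1) fin sum_nonneg_eq_0_iff[of "X - {y}" u] by auto
  then have "(\<Sum>z\<in>X. u z *\<^sub>R z) = y"
    using \<open>u y = 1\<close> y(1) fin by (simp add: sum.remove)
  then show ?thesis using u(3) y(1) by simp
qed

lemma int_point_of_unimodular_simplex:
  fixes X :: "(real ^ 'n) set"
  assumes card: "card X = CARD('n) + 1"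
    and X: "X \<subseteq> int_lattice"
    and vol: "measure lebesgue (convex hull X) = 1 / fact CARD('n)"
    and x: "x \<in> convex hull X" "x \<in> int_lattice"
  shows "x \<in> X"
proof -
  let ?r = "\<lambda>y :: real ^ 'n. (\<chi> i. y $ Rep_wellordered_copy i) :: real ^ 'n wellordered_copy"
  have lin: "linear ?r" by (rule linearI) (simp_all add: vec_eq_iff)
  have inj: "inj ?r"
    by (rule injI) (metis Abs_wellordered_copy_inverse UNIV_I vec_eq_iff vec_lambda_beta)
  have fin: "finite X" using card by (simp add: card_ge_0_finite)
  have hull: "convex hull (?r ` X) = ?r ` (convex hull X)"
    using lin by (simp add: convex_hull_linear_image)
  have "?r x \<in> ?r ` X"
  proof (rule int_point_of_unimodular_simplex_wo)
    show "card (?r ` X) = CARD('n wellordered_copy) + 1"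
      using card inj by (simp add: card_image inj_on_subset CARD_wellordered_copy)
    show "?r ` X \<subseteq> int_lattice" using X by (auto simp: int_lattice_def)
    show "measure lebesgue (convex hull (?r ` X)) = 1 / fact CARD('n wellordered_copy)"
      using fin vol
      by (simp add: hull measure_reindex bij_Rep_wellordered_copy finite_imp_compact_convex_hull CARD_wellordered_copy)
    show "?r x \<in> convex hull (?r ` X)" using x by (simp add: hull)
    show "?r x \<in> int_lattice" using x by (auto simp: int_lattice_def)
  qed
  then show ?thesis using inj_image_mem_iff[OF inj] by blast
qed

section \<open>Simplices and dual cells of a primitive triangulation\<close>

definition vertices :: "(real ^ 'n) set \<Rightarrow> (real ^ 'n) set" where
  "vertices \<tau> = {v. v extreme_point_of \<tau>}"

definition facets :: "(real ^ 'n) set set \<Rightarrow> (real ^ 'n) set set" where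
  "facets K = {\<tau> \<in> K. \<forall>\<rho>\<in>K. \<tau> \<subseteq> \<rho> \<longrightarrow> \<rho> = \<tau>}"

text \<open>
  If the interior of a segment in \<open>S\<close> meets a face, then the face contains the end points.
\<close>

lemma convex_Diff_face:
  assumes "convex S" "T face_of S"
  shows "convex (S - T)"
  unfolding convex_contains_open_segment
proof (intro ballI subsetI)
  fix a b z assume ab: "a \<in> S - T" "b \<in> S - T" and z: "z \<in> open_segment a b"
  have "z \<in> S" using assms(1) ab z by (auto simp: convex_contains_open_segment)
  moreover have "z \<notin> T" using face_ofD[OF assms(2) z] ab by auto
  ultimately show "z \<in> S - T" by simp
qed

locale unimodular_triangulation =
  fixes P :: "(real ^ 'n) set" and K :: "(real ^ 'n) set set"
  assumes primitive: "primitive_triangulation P K"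
begin

lemma simplicial_complex_K: "simplicial_complex K"
  and Union_K: "\<Union>K = P"
  and extreme_points_int: "\<tau> \<in> K \<Longrightarrow> v extreme_point_of \<tau> \<Longrightarrow> v \<in> int_lattice"
  using primitive by (simp_all add: primitive_triangulation_def)

lemma finite_K: "finite K"
  and face_in_K: "\<tau> \<in> K \<Longrightarrow> F face_of \<tau> \<Longrightarrow> F \<in> K"
  and Int_face: "\<tau> \<in> K \<Longrightarrow> \<rho> \<in> K \<Longrightarrow> (\<tau> \<inter> \<rho>) face_of \<tau>"
  and simplex_in_K: "\<tau> \<in> K \<Longrightarrow> \<exists>n. n simplex \<tau>"
  using simplicial_complex_K by (auto simp: simplicial_complex_def)

lemma simplex_hull_vertices:
  assumes "\<tau> \<in> K"
  shows "finite (vertices \<tau>)" "\<not> affine_dependent (vertices \<tau>)"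
    "convex hull (vertices \<tau>) = \<tau>" "vertices \<tau> \<subseteq> int_lattice"
proof -
  obtain n C where C: "\<not> affine_dependent C" "\<tau> = convex hull C"
    using simplex_in_K[OF assms] by (auto simp: simplex_def)
  then have "vertices \<tau> = C"
    by (auto simp: vertices_def extreme_point_of_convex_hull_affine_independent)
  then show "finite (vertices \<tau>)" "\<not> affine_dependent (vertices \<tau>)" "convex hull (vertices \<tau>) = \<tau>"
    using C aff_independent_finite by auto
  show "vertices \<tau> \<subseteq> int_lattice"
    using extreme_points_int[OF assms] by (auto simp: vertices_def)
qed

lemma compact_simplex: "\<tau> \<in> K \<Longrightarrow> compact \<tau>"
  using simplex_hull_vertices by (metis finite_imp_compact_convex_hull)

lemma convex_simplex: "\<tau> \<in> K \<Longrightarrow> convex \<tau>"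
  using simplex_hull_vertices by (metis convex_convex_hull)

lemma vertices_subset: "\<tau> \<in> K \<Longrightarrow> vertices \<tau> \<subseteq> \<tau>"
  by (auto simp: vertices_def extreme_point_of_def)

text \<open>
  Any set of vertices of a simplex spans a face of it.
\<close>

lemma hull_in_K:
  assumes "\<tau> \<in> K" "C \<subseteq> vertices \<tau>"
  shows "convex hull C \<in> K"
  using assms simplex_hull_vertices[OF assms(1)] face_in_K[OF assms(1)]
    face_of_convex_hull_affine_independent[of "vertices \<tau>" "convex hull C"] by auto

lemma edge_in_K: "\<tau> \<in> K \<Longrightarrow> a \<in> vertices \<tau> \<Longrightarrow> b \<in> vertices \<tau> \<Longrightarrow> closed_segment a b \<in> K"
  using hull_in_K[of \<tau> "{a, b}"] by (simp add: segment_convex_hull)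

text \<open>
  A face of a simplex that contains its barycenter is therefore the whole simplex. This is how
  membership of a barycenter in a simplex turns into inclusion of simplices.
\<close>

lemma barycenter_in_rel_interior:
  assumes "\<tau> \<in> K" "\<tau> \<noteq> {}"
  shows "barycenter \<tau> \<in> rel_interior \<tau>"
proof -
  let ?V = "vertices \<tau>"
  note V = simplex_hull_vertices[OF assms(1)]
  have "?V \<noteq> {}" using V assms(2) by auto
  then have c: "card ?V > 0" using V by (simp add: card_gt_0_iff)
  have "rel_interior (convex hull ?V) =
      {y. \<exists>u. (\<forall>x\<in>?V. 0 < u x) \<and> sum u ?V = 1 \<and> (\<Sum>x\<in>?V. u x *\<^sub>R x) = y}"
    by (rule rel_interior_convex_hull_explicit[OF V(2)])
  moreover have "barycenter \<tau> = (\<Sum>x\<in>?V. (1 / real (card ?V)) *\<^sub>R x)"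
    by (simp add: barycenter_def vertices_def scaleR_sum_right)
  ultimately have "barycenter \<tau> \<in> rel_interior (convex hull ?V)"
    using c by (auto intro!: exI[of _ "\<lambda>_. 1 / real (card ?V)"])
  then show ?thesis using V by simp
qed

lemma barycenter_in_simplex: "\<tau> \<in> K \<Longrightarrow> \<tau> \<noteq> {} \<Longrightarrow> barycenter \<tau> \<in> \<tau>"
  using barycenter_in_rel_interior rel_interior_subset by blast

text \<open>
  The largest member of the flag contains all the barycenters. Nonemptiness of \<open>\<sigma>\<close> keeps the
  empty simplex, whose barycenter is \<open>0\<close> by convention, out of the flag.
\<close>

lemma chain_hull_in_simplex:
  assumes F: "subset.chain K F" "\<forall>\<tau>\<in>F. \<sigma> \<subseteq> \<tau>" and \<sigma>: "\<sigma> \<noteq> {}"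
    and x: "x \<in> convex hull (barycenter ` F)"
  obtains \<tau> where "\<tau> \<in> K" "\<sigma> \<subseteq> \<tau>" "convex hull (barycenter ` F) \<subseteq> \<tau>"
proof -
  have FK: "F \<subseteq> K" using F by (simp add: subset_chain_def)
  then have "finite F" using finite_K finite_subset by blast
  moreover have "F \<noteq> {}" using x by auto
  ultimately obtain \<tau> where \<tau>: "\<tau> \<in> F" "\<forall>\<rho>\<in>F. \<tau> \<subseteq> \<rho> \<longrightarrow> \<tau> = \<rho>"
    using finite_has_maximal[of F] by blast
  have sub: "\<rho> \<subseteq> \<tau>" if "\<rho> \<in> F" for \<rho>
  proof -
    have "\<rho> \<subseteq> \<tau> \<or> \<tau> \<subseteq> \<rho>" using F(1) that \<tau>(1) by (simp add: subset_chain_def)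
    then show ?thesis using \<tau>(2) that by auto
  qed
  have "barycenter \<rho> \<in> \<tau>" if "\<rho> \<in> F" for \<rho>
  proof -
    have "\<rho> \<noteq> {}" "\<rho> \<in> K" using F(2) \<sigma> FK that by auto
    then show ?thesis using barycenter_in_simplex sub[OF that] by blast
  qed
  then have "convex hull (barycenter ` F) \<subseteq> \<tau>"
    using convex_simplex \<tau> FK by (intro hull_minimal) auto
  moreover have "\<tau> \<in> K" "\<sigma> \<subseteq> \<tau>" using \<tau>(1) F(2) FK by auto
  ultimately show ?thesis by (rule that[rotated 2])
qed

lemma dual_cell_in_simplex:
  assumes "x \<in> dual_cell K \<sigma>" "\<sigma> \<noteq> {}"
  obtains \<tau> where "\<tau> \<in> K" "\<sigma> \<subseteq> \<tau>" "x \<in> \<tau>"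
proof -
  obtain F where F: "subset.chain K F" "\<forall>\<tau>\<in>F. \<sigma> \<subseteq> \<tau>" "x \<in> convex hull (barycenter ` F)"
    using assms(1) by (auto simp: dual_cell_def)
  obtain \<tau> where "\<tau> \<in> K" "\<sigma> \<subseteq> \<tau>" "convex hull (barycenter ` F) \<subseteq> \<tau>"
    using chain_hull_in_simplex[OF F(1,2) assms(2) F(3)] .
  with F(3) show ?thesis by (intro that[of \<tau>]) auto
qed

text \<open>
  The point \<open>x\<close> is a convex combination of barycenters of simplices above \<open>\<sigma>\<close>, all contained in
  one simplex \<open>\<tau>\<close>, and \<open>x\<close> lies in the face \<open>\<tau> \<inter> \<rho>\<close> of \<open>\<tau>\<close>. As the complement of a face is convex,
  one of these barycenters lies in \<open>\<rho>\<close>, and with it the simplex that it is the barycenter of.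
  Thus dual cells stay away from the simplices that do not contain \<open>\<sigma>\<close>.
\<close>

lemma simplex_meeting_dual_cell:
  assumes x: "x \<in> dual_cell K \<sigma>" "x \<in> \<rho>" and \<rho>: "\<rho> \<in> K" and \<sigma>: "\<sigma> \<noteq> {}"
  shows "\<sigma> \<subseteq> \<rho>"
proof -
  obtain F where F: "subset.chain K F" "\<forall>\<tau>\<in>F. \<sigma> \<subseteq> \<tau>" and xF: "x \<in> convex hull (barycenter ` F)"
    using x(1) by (auto simp: dual_cell_def)
  obtain \<tau> where \<tau>: "\<tau> \<in> K" "\<sigma> \<subseteq> \<tau>" "convex hull (barycenter ` F) \<subseteq> \<tau>"
    using chain_hull_in_simplex[OF F \<sigma> xF] .
  have face: "(\<tau> \<inter> \<rho>) face_of \<tau>" using Int_face \<tau> \<rho> by blast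
  have "\<exists>b\<in>barycenter ` F. b \<in> \<tau> \<inter> \<rho>"
  proof (rule ccontr)
    assume "\<not> ?thesis"
    then have "barycenter ` F \<subseteq> \<tau> - (\<tau> \<inter> \<rho>)"
      using \<tau>(3) hull_subset[of "barycenter ` F" convex] by blast
    moreover have "convex (\<tau> - (\<tau> \<inter> \<rho>))"
      using convex_Diff_face face convex_simplex \<tau> by blast
    ultimately have "convex hull (barycenter ` F) \<subseteq> \<tau> - (\<tau> \<inter> \<rho>)"
      by (rule hull_minimal)
    then show False using xF x(2) \<tau>(3) by blast
  qed
  then obtain \<upsilon> where \<upsilon>: "\<upsilon> \<in> F" "barycenter \<upsilon> \<in> \<tau> \<inter> \<rho>" by blast
  have \<upsilon>K: "\<upsilon> \<in> K" using \<upsilon> F by (auto simp: subset_chain_def)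
  have \<upsilon>0: "\<upsilon> \<noteq> {}" using \<upsilon> F \<sigma> by blast
  have "(\<upsilon> \<inter> \<rho>) face_of \<upsilon>" using Int_face \<upsilon>K \<rho> by blast
  moreover have "barycenter \<upsilon> \<in> (\<upsilon> \<inter> \<rho>) \<inter> rel_interior \<upsilon>"
    using barycenter_in_rel_interior[OF \<upsilon>K \<upsilon>0] rel_interior_subset \<upsilon> by blast
  ultimately have "\<upsilon> \<subseteq> \<upsilon> \<inter> \<rho>"
    using subset_of_face_of[of "\<upsilon> \<inter> \<rho>" \<upsilon> \<upsilon>] by blast
  then show ?thesis using F \<upsilon> by blast
qed

lemma dual_cell_subset_support: "\<sigma> \<noteq> {} \<Longrightarrow> dual_cell K \<sigma> \<subseteq> P"
  using dual_cell_in_simplex Union_K by (metis UnionI subsetI)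

lemma compact_dual_cell: "compact (dual_cell K \<sigma>)"
proof -
  have "{convex hull (barycenter ` F) | F. subset.chain K F \<and> (\<forall>\<tau>\<in>F. \<sigma> \<subseteq> \<tau>)}
      \<subseteq> (\<lambda>F. convex hull (barycenter ` F)) ` Pow K"
    by (auto simp: subset_chain_def)
  then have "finite {convex hull (barycenter ` F) | F. subset.chain K F \<and> (\<forall>\<tau>\<in>F. \<sigma> \<subseteq> \<tau>)}"
    using finite_K by (meson finite_Pow_iff finite_imageI finite_subset)
  moreover have "compact (convex hull (barycenter ` F))" if "subset.chain K F" for F
    using that finite_K finite_subset finite_imp_compact_convex_hull
    by (metis finite_imageI subset_chain_def)
  ultimately show ?thesis
    unfolding dual_cell_def by (intro compact_Union) auto
qed

lemma barycenter_in_dual_cell: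
  assumes "\<tau> \<in> K" "\<sigma> \<subseteq> \<tau>"
  shows "barycenter \<tau> \<in> dual_cell K \<sigma>"
proof -
  have "subset.chain K {\<tau>}" using assms by (simp add: subset_chain_def)
  moreover have "barycenter \<tau> \<in> convex hull (barycenter ` {\<tau>})" by simp
  ultimately show ?thesis
    unfolding dual_cell_def using assms by (intro UnionI CollectI exI[of _ "{\<tau>}"] conjI) auto
qed

text \<open>
  Adding \<open>\<sigma>\<close> to a flag above \<open>\<sigma>\<close> gives a flag again, so the cell is a union of convex sets that
  all contain the barycenter of \<open>\<sigma>\<close>.
\<close>

lemma connected_dual_cell:
  assumes "\<sigma> \<in> K"
  shows "connected (dual_cell K \<sigma>)"
proof -
  let ?C = "{F. subset.chain K F \<and> (\<forall>\<tau>\<in>F. \<sigma> \<subseteq> \<tau>)}"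
  let ?H = "\<lambda>F. convex hull (barycenter ` F)"
  have ins: "insert \<sigma> F \<in> ?C" if "F \<in> ?C" for F
    using that assms by (auto simp: subset_chain_def)
  have mono: "?H F \<subseteq> ?H (insert \<sigma> F)" for F
    by (rule hull_mono) auto
  have "dual_cell K \<sigma> = (\<Union>F\<in>?C. ?H F)"
    by (auto simp: dual_cell_def)
  also have "\<dots> = (\<Union>F\<in>?C. ?H (insert \<sigma> F))"
  proof (rule subset_antisym; rule UN_least)
    show "?H F \<subseteq> (\<Union>F\<in>?C. ?H (insert \<sigma> F))" if "F \<in> ?C" for F
      using UN_upper[OF that, of "\<lambda>F. ?H (insert \<sigma> F)"] mono[of F] by (rule subset_trans[rotated])
    show "?H (insert \<sigma> F) \<subseteq> (\<Union>F\<in>?C. ?H F)" if "F \<in> ?C" for F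
      using UN_upper[OF ins[OF that], of ?H] .
  qed
  also have "connected \<dots>"
  proof (rule connected_Union)
    show "connected s" if "s \<in> (\<lambda>F. ?H (insert \<sigma> F)) ` ?C" for s
      using that by (auto simp del: image_insert intro!: convex_connected)
    have "barycenter \<sigma> \<in> \<Inter> ((\<lambda>F. ?H (insert \<sigma> F)) ` ?C)"
      by (auto intro!: hull_inc)
    then show "\<Inter> ((\<lambda>F. ?H (insert \<sigma> F)) ` ?C) \<noteq> {}" by auto
  qed
  finally show ?thesis .
qed

lemma facets_subset: "facets K \<subseteq> K" by (auto simp: facets_def)

lemma finite_facets: "finite (facets K)" using facets_subset finite_K finite_subset by blast

lemma subset_facet:
  assumes "\<tau> \<in> K"
  obtains \<rho> where "\<rho> \<in> facets K" "\<tau> \<subseteq> \<rho>"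
proof -
  obtain \<rho> where "\<rho> \<in> K" "\<tau> \<subseteq> \<rho>" "\<forall>b\<in>K. \<rho> \<subseteq> b \<longrightarrow> \<rho> = b"
    using finite_has_maximal2[OF finite_K assms] by auto
  then show ?thesis by (intro that[of \<rho>]) (auto simp: facets_def)
qed

lemma measure_facet: "\<tau> \<in> facets K \<Longrightarrow> measure lebesgue \<tau> = 1 / fact CARD('n)"
  using primitive by (auto simp: primitive_triangulation_def facets_def)

lemma not_negligible_facet: "\<tau> \<in> facets K \<Longrightarrow> \<not> negligible \<tau>"
  using measure_facet negligible_imp_measure0 by fastforce

lemma aff_dim_facet:
  assumes "\<tau> \<in> facets K"
  shows "aff_dim \<tau> = int CARD('n)"
proof -
  have "interior \<tau> \<noteq> {}"
    using not_negligible_facet[OF assms] negligible_convex_interior convex_simplex facets_subset assms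
    by blast
  then show ?thesis using aff_dim_nonempty_interior by fastforce
qed

lemma card_vertices_facet:
  assumes "\<tau> \<in> facets K"
  shows "card (vertices \<tau>) = CARD('n) + 1"
proof -
  note V = simplex_hull_vertices[of \<tau>]
  have "\<tau> \<in> K" using assms facets_subset by blast
  then have "aff_dim \<tau> = int (card (vertices \<tau>)) - 1"
    using V aff_dim_convex_hull affine_independent_iff_card by metis
  then show ?thesis using aff_dim_facet[OF assms] by simp
qed

lemma lattice_point_facet:
  assumes "\<tau> \<in> facets K" "x \<in> \<tau>" "x \<in> int_lattice"
  shows "x \<in> vertices \<tau>"
proof -
  have K: "\<tau> \<in> K" using assms facets_subset by blast
  show ?thesis
    by (rule int_point_of_unimodular_simplex)
       (use assms measure_facet[OF assms(1)] simplex_hull_vertices[OF K] card_vertices_facet in simp_all)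
qed

text \<open>
  Two different facets meet in a proper face of both, which is a null set.
\<close>

lemma card_facets: "real (card (facets K)) = fact CARD('n) * measure lebesgue P"
proof -
  have "measure lebesgue (\<Union>(facets K)) = (\<Sum>\<tau>\<in>facets K. measure lebesgue \<tau>)"
  proof (rule measure_negligible_finite_Union)
    show "pairwise (\<lambda>S T. negligible (S \<inter> T)) (facets K)"
    proof (rule pairwiseI)
      fix S T assume S: "S \<in> facets K" and T: "T \<in> facets K" and "S \<noteq> T"
      then have K: "S \<in> K" "T \<in> K" using facets_subset by auto
      have "S \<inter> T \<noteq> S" using S T K \<open>S \<noteq> T\<close> unfolding facets_def by blast
      then have "aff_dim (S \<inter> T) < aff_dim S"
        using face_of_aff_dim_lt Int_face convex_simplex K by blast
      then have "aff_dim (S \<inter> T) \<noteq> int DIM(real ^ 'n)" using aff_dim_facet[OF S] by simp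
      then have "interior (S \<inter> T) = {}" using aff_dim_nonempty_interior by blast
      then show "negligible (S \<inter> T)"
        using negligible_convex_interior[OF convex_Int[OF convex_simplex convex_simplex], OF K] by simp
    qed
  qed (use finite_facets facets_subset compact_simplex lmeasurable_compact in auto)
  moreover have "\<Union>(facets K) = P"
    using Union_K facets_subset subset_facet by (metis Union_mono Union_subsetI subset_antisym)
  ultimately have "measure lebesgue P = real (card (facets K)) * (1 / fact CARD('n))"
    using measure_facet by simp
  then show ?thesis by simp
qed

end

section \<open>Topology of the real locus\<close>

lemma UNIV_bit: "(UNIV :: bit set) = {0, 1}"
  using bit_not_zero_iff by blast

instance bit :: finite
  by standard (simp add: UNIV_bit)

lemma topspace_real_locus: "topspace (real_locus P) = locus_proj P ` (UNIV \<times> P)"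
  using quotient_imp_surjective_map[OF quotient_map_quotient_topology[of
      "prod_topology (discrete_topology UNIV) (top_of_set P)" "locus_proj P"]]
  by (simp add: real_locus_def)

lemma locus_proj_eq_imp:
  assumes "x \<in> P" "locus_proj P (u, x) = locus_proj P (u', x')"
  shows "x' = x" "u' - u \<in> sed (smallest_face P x)"
proof -
  have "0 \<in> sed (smallest_face P x)"
    unfolding sed_def
    by (rule image_eqI[of _ _ 0])
       (auto simp: mod2_def int_lattice_def vec_eq_iff orthogonal_comp_def orthogonal_def)
  then have "(u, x) \<in> locus_proj P (u, x)"
    using assms(1) by (simp add: locus_proj_def locus_rel_def)
  then have "(u, x) \<in> locus_proj P (u', x')" using assms(2) by simp
  then show "x' = x" "u' - u \<in> sed (smallest_face P x)"
    by (auto simp: locus_proj_def locus_rel_def)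
qed

text \<open>
  A face of \<open>P\<close> containing an interior point is \<open>P\<close> itself, and \<open>P\<close> spans the whole space. The
  assumption on faces is phrased through \<open>v\<close> because for points of the open star of \<open>v\<close> it follows
  from the combinatorics of the triangulation.
\<close>

lemma sed_eq_0:
  assumes P: "convex P" and v: "v \<in> interior P" and faces: "\<And>Q. Q face_of P \<Longrightarrow> x \<in> Q \<Longrightarrow> v \<in> Q"
    and x: "x \<in> P"
  shows "sed (smallest_face P x) = {0}"
proof -
  have "Q = P" if "Q face_of P" "x \<in> Q" for Q
    using face_of_disjoint_interior[OF that(1)] faces[OF that] v by auto
  then have face: "smallest_face P x = P"
    using face_of_refl[OF P] x by (auto simp: smallest_face_def)
  have "z \<in> tangent_space P" for z
  proof -
    obtain e where e: "e > 0" "ball v e \<subseteq> P" using v by (auto simp: mem_interior)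
    \<comment> \<open>A scale at which \<open>v + t z\<close> stays in the ball.\<close>
    define t where "t = e / (2 * (norm z + 1))"
    have t: "t > 0" using e(1) by (simp add: t_def add_nonneg_pos)
    have "t * norm z < e"
    proof -
      have "norm z / (2 * (norm z + 1)) < 1" by (simp add: add_nonneg_pos)
      then have "e * (norm z / (2 * (norm z + 1))) < e * 1"
        using e(1) by (intro mult_strict_left_mono)
      then show ?thesis by (simp add: t_def)
    qed
    then have "v + t *\<^sub>R z \<in> P" using e t by (auto simp: dist_norm)
    moreover have "v \<in> P" using v interior_subset by blast
    ultimately have "t *\<^sub>R z \<in> tangent_space P"
      unfolding tangent_space_def
      by (intro span_base CollectI exI[of _ "v + t *\<^sub>R z"] exI[of _ v]) simp
    then have "(1 / t) *\<^sub>R t *\<^sub>R z \<in> tangent_space P"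
      unfolding tangent_space_def by (rule span_scale)
    then show ?thesis using t by simp
  qed
  then have "tangent_space P = UNIV" by blast
  moreover have "z = 0" if "z \<in> orthogonal_comp UNIV" for z :: "real ^ 'n"
  proof -
    have "z \<bullet> z = 0" using that unfolding orthogonal_comp_def orthogonal_def by blast
    then show ?thesis by simp
  qed
  moreover have "0 \<in> orthogonal_comp UNIV" by (simp add: orthogonal_comp_def orthogonal_def)
  ultimately have "orthogonal_comp (tangent_space P) = {0}" by auto
  then show ?thesis
    by (simp add: face sed_def int_lattice_def mod2_def vec_eq_iff)
qed

text \<open>
  Over points with trivial \<open>sed\<close> nothing is glued, so sets in the copy \<open>u = 0\<close> are saturated;
  hence open and closed sets there stay open and closed in the real locus.
\<close>

lemma preimage_locus_proj:
  assumes "U \<subseteq> P" "\<And>x. x \<in> U \<Longrightarrow> sed (smallest_face P x) = {0}"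
  shows "{z \<in> UNIV \<times> P. locus_proj P z \<in> locus_proj P ` ({0} \<times> U)} = {0} \<times> U"
proof -
  have "u = 0 \<and> x \<in> U"
    if "x' \<in> U" "locus_proj P (0, x') = locus_proj P (u, x)" for u x x'
    using locus_proj_eq_imp[OF _ that(2)] assms that(1) by auto
  then show ?thesis using assms(1) by (fastforce dest: sym)
qed

lemma openin_locus_proj:
  assumes "openin (top_of_set P) U" "\<And>x. x \<in> U \<Longrightarrow> sed (smallest_face P x) = {0}"
  shows "openin (real_locus P) (locus_proj P ` ({0} \<times> U))"
proof -
  have U: "U \<subseteq> P" using openin_subset[OF assms(1)] by simp
  show ?thesis
    unfolding real_locus_def openin_quotient_topology
    using preimage_locus_proj[OF U assms(2)] U assms(1)
    by (auto simp: openin_prod_Times_iff)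
qed

lemma closedin_locus_proj:
  assumes "closedin (top_of_set P) U" "\<And>x. x \<in> U \<Longrightarrow> sed (smallest_face P x) = {0}"
  shows "closedin (real_locus P) (locus_proj P ` ({0} \<times> U))"
proof -
  let ?T = "prod_topology (discrete_topology UNIV) (top_of_set P)"
  have U: "U \<subseteq> P" using closedin_subset[OF assms(1)] by simp
  have "closedin ?T {z \<in> topspace ?T. locus_proj P z \<in> locus_proj P ` ({0} \<times> U)}"
    using preimage_locus_proj[OF U assms(2)] assms(1) by (simp add: closedin_prod_Times_iff)
  moreover have "locus_proj P ` ({0} \<times> U) \<subseteq> topspace (real_locus P)"
    unfolding topspace_real_locus using U by auto
  ultimately show ?thesis
    using quotient_map_quotient_topology[of ?T "locus_proj P"]
    unfolding quotient_map_closedin real_locus_def by blast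
qed

lemma connectedin_locus_proj:
  assumes "connected D" "D \<subseteq> P"
  shows "connectedin (real_locus P) (locus_proj P ` ({u} \<times> D))"
proof -
  let ?T = "prod_topology (discrete_topology UNIV) (top_of_set P)"
  have "continuous_map ?T (real_locus P) (locus_proj P)"
    unfolding real_locus_def by (rule quotient_imp_continuous_map[OF quotient_map_quotient_topology])
  moreover have "connectedin ?T ({u} \<times> D)"
    using assms by (simp add: connectedin_Times connectedin_subtopology)
  ultimately show ?thesis by (rule connectedin_continuous_map_image)
qed

text \<open>
  The component of a point of a clopen set stays inside it, so disjoint nonempty clopen sets have
  different components. Finiteness guards against \<open>card\<close> being 0 on infinite sets.
\<close>

lemma card_clopen_le_b0:
  assumes fin: "finite (connected_components_of X)"
    and clopen: "\<And>i. i \<in> I \<Longrightarrow> openin X (A i)" "\<And>i. i \<in> I \<Longrightarrow> closedin X (A i)"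
    and ne: "\<And>i. i \<in> I \<Longrightarrow> A i \<noteq> {}"
    and disj: "\<And>i j. i \<in> I \<Longrightarrow> j \<in> I \<Longrightarrow> i \<noteq> j \<Longrightarrow> A i \<inter> A j = {}"
  shows "card I \<le> b0 X"
  unfolding b0_def
proof (rule card_inj_on_le[OF _ _ fin])
  let ?p = "\<lambda>i. SOME x. x \<in> A i"
  let ?c = "\<lambda>i. connected_component_of_set X (?p i)"
  have p: "?p i \<in> A i" if "i \<in> I" for i using ne[OF that] by (simp add: some_in_eq)
  have top: "?p i \<in> topspace X" if "i \<in> I" for i
    using p[OF that] closedin_subset[OF clopen(2)[OF that]] by blast
  have sub: "?c i \<subseteq> A i" if "i \<in> I" for i
  proof -
    have "?p i \<in> ?c i" using top[OF that] by (simp add: connected_component_of_refl)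
    then show ?thesis
      using connectedin_clopen_cases[OF connectedin_connected_component_of clopen(2)[OF that] clopen(1)[OF that], of "?p i"]
        p[OF that] by (auto simp: disjnt_iff)
  qed
  show "inj_on ?c I"
  proof (rule inj_onI, rule ccontr)
    fix i j assume ij: "i \<in> I" "j \<in> I" "?c i = ?c j" "i \<noteq> j"
    have "?p i \<in> ?c i" using top[OF ij(1)] by (simp add: connected_component_of_refl)
    then have "?p i \<in> A i \<inter> A j" using ij sub[OF ij(1)] sub[OF ij(2)] by auto
    then show False using disj ij by auto
  qed
  show "?c ` I \<subseteq> connected_components_of X"
    using top by (auto simp: connected_components_of_def)
qed

section \<open>The number of components is at most linear in the number of facets\<close>

context unimodular_triangulation
begin

lemma T_hypersurface_cases:
  assumes "y \<in> T_hypersurface P K \<epsilon>"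
  obtains u a b x where "a \<noteq> b" "closed_segment a b \<in> K" "pair2 (a - b) u + \<epsilon> a + \<epsilon> b = 1"
    "x \<in> dual_cell K (closed_segment a b)" "y = locus_proj P (u, x)"
  using assms unfolding T_hypersurface_def by auto

lemma T_hypersurface_cell:
  assumes "a \<noteq> b" "closed_segment a b \<in> K" "pair2 (a - b) u + \<epsilon> a + \<epsilon> b = 1"
  shows "locus_proj P ` ({u} \<times> dual_cell K (closed_segment a b)) \<subseteq> T_hypersurface P K \<epsilon>"
  unfolding T_hypersurface_def using assms by (intro Union_upper CollectI exI conjI) auto

text \<open>
  Every component contains a whole cell, and every cell contains the image of \<open>(u, barycenter \<tau>)\<close>
  for a facet \<open>\<tau>\<close>. These points are indexed by \<open>u\<close> and \<open>\<tau>\<close>.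
\<close>

lemma components_T_hypersurface:
  fixes \<epsilon>
  defines "X \<equiv> subtopology (real_locus P) (T_hypersurface P K \<epsilon>)"
  shows "finite (connected_components_of X)"
    and "b0 X \<le> CARD(bit ^ 'n) * card (facets K)"
proof -
  let ?g = "\<lambda>(u, \<tau>). connected_component_of_set X (locus_proj P (u, barycenter \<tau>))"
  have sub: "connected_components_of X \<subseteq> ?g ` (UNIV \<times> facets K)"
  proof
    fix C assume "C \<in> connected_components_of X"
    then obtain y where y: "y \<in> topspace X" "C = connected_component_of_set X y"
      by (auto simp: connected_components_of_def)
    then have "y \<in> T_hypersurface P K \<epsilon>" by (simp add: X_def)
    then obtain u a b x where cell: "a \<noteq> b" "closed_segment a b \<in> K" "pair2 (a - b) u + \<epsilon> a + \<epsilon> b = 1"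
      and x: "x \<in> dual_cell K (closed_segment a b)" "y = locus_proj P (u, x)"
      by (rule T_hypersurface_cases)
    let ?D = "dual_cell K (closed_segment a b)"
    obtain \<tau> where \<tau>: "\<tau> \<in> facets K" "closed_segment a b \<subseteq> \<tau>"
      using subset_facet[OF cell(2)] .
    have "connectedin (real_locus P) (locus_proj P ` ({u} \<times> ?D))"
      using connected_dual_cell[OF cell(2)] dual_cell_subset_support[of "closed_segment a b"]
      by (intro connectedin_locus_proj) auto
    then have "connectedin X (locus_proj P ` ({u} \<times> ?D))"
      using T_hypersurface_cell[OF cell] by (simp add: X_def connectedin_subtopology)
    moreover have "y \<in> locus_proj P ` ({u} \<times> ?D)" using x by auto
    moreover have "locus_proj P (u, barycenter \<tau>) \<in> locus_proj P ` ({u} \<times> ?D)"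
      using barycenter_in_dual_cell[of \<tau>] \<tau> facets_subset by auto
    ultimately have "connected_component_of X y (locus_proj P (u, barycenter \<tau>))"
      unfolding connected_component_of_def by blast
    then have "C = ?g (u, \<tau>)"
      unfolding y(2) by (simp add: connected_component_of_equiv)
    then show "C \<in> ?g ` (UNIV \<times> facets K)" using \<tau>(1) by blast
  qed
  have fin: "finite (UNIV \<times> facets K :: ((bit ^ 'n) \<times> _) set)" using finite_facets by simp
  show "finite (connected_components_of X)"
    using sub fin finite_subset by blast
  have "b0 X \<le> card (UNIV \<times> facets K :: ((bit ^ 'n) \<times> _) set)"
    unfolding b0_def using sub fin surj_card_le by blast
  then show "b0 X \<le> CARD(bit ^ 'n) * card (facets K)" by (simp add: card_cartesian_product)
qed

lemma b0_le_facets: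
  "b0_T_hypersurface P K \<epsilon> \<le> CARD(bit ^ 'n) * card (facets K)"
  unfolding b0_T_hypersurface_def by (rule components_T_hypersurface)

end

section \<open>Isolated lattice points give components\<close>

definition star_vertices :: "(real ^ 'n) set set \<Rightarrow> real ^ 'n \<Rightarrow> (real ^ 'n) set" where
  "star_vertices K v = \<Union>{vertices \<tau> | \<tau>. \<tau> \<in> facets K \<and> v \<in> vertices \<tau>}"

text \<open>
  In barycentric terms: the points of the triangulated polytope whose coordinate at \<open>v\<close> is
  positive.
\<close>

definition open_star :: "(real ^ 'n) set set \<Rightarrow> real ^ 'n \<Rightarrow> (real ^ 'n) set" where
  "open_star K v = \<Union>K - \<Union>{\<tau> \<in> K. v \<notin> \<tau>}"

text \<open>
  The sign of \<open>v\<close> itself is fixed to 1, so that two isolated points can never be adjacent.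
\<close>

definition isolated :: "(real ^ 'n) set set \<Rightarrow> (real ^ 'n \<Rightarrow> bit) \<Rightarrow> real ^ 'n \<Rightarrow> bool" where
  "isolated K \<epsilon> v \<longleftrightarrow> \<epsilon> v = 1 \<and> (\<forall>w\<in>star_vertices K v - {v}. \<epsilon> w = 0)"

text \<open>
  The union of the cells dual to the edges at \<open>v\<close>; for a vertex \<open>v\<close> inside the polytope this is
  the boundary sphere of the dual cell of \<open>v\<close>.
\<close>

definition vertex_sphere :: "(real ^ 'n) set set \<Rightarrow> real ^ 'n \<Rightarrow> (real ^ 'n) set" where
  "vertex_sphere K v = \<Union>{dual_cell K (closed_segment v w) | w. w \<noteq> v \<and> closed_segment v w \<in> K}"

context unimodular_triangulation
begin

lemma openin_open_star: "openin (top_of_set P) (open_star K v)"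
proof -
  have "closed (\<Union>{\<tau> \<in> K. v \<notin> \<tau>})"
    using finite_K compact_simplex by (intro closed_Union) (auto intro: compact_imp_closed)
  then show ?thesis
    unfolding open_star_def Union_K by (auto simp: openin_closedin_eq closedin_closed)
qed

lemma open_star_simplex: "x \<in> open_star K v \<Longrightarrow> \<tau> \<in> K \<Longrightarrow> x \<in> \<tau> \<Longrightarrow> v \<in> \<tau>"
  by (auto simp: open_star_def)

lemma open_star_facet:
  assumes "x \<in> open_star K v"
  obtains \<tau> where "\<tau> \<in> facets K" "x \<in> \<tau>" "v \<in> \<tau>"
proof -
  obtain \<rho> where "\<rho> \<in> K" "x \<in> \<rho>" using assms by (auto simp: open_star_def)
  moreover obtain \<tau> where "\<tau> \<in> facets K" "\<rho> \<subseteq> \<tau>" using subset_facet[OF \<open>\<rho> \<in> K\<close>] .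
  moreover have "v \<in> \<rho>" using open_star_simplex[OF assms \<open>\<rho> \<in> K\<close> \<open>x \<in> \<rho>\<close>] .
  ultimately show ?thesis using that by blast
qed

text \<open>
  A face \<open>Q\<close> of \<open>P\<close> through \<open>x\<close> cuts any simplex at \<open>x\<close> in a face, which is again a simplex of the
  triangulation through \<open>x\<close>, so it contains \<open>v\<close>.
\<close>

lemma sed_open_star:
  assumes "convex P" "v \<in> interior P" "x \<in> open_star K v"
  shows "sed (smallest_face P x) = {0}"
proof (rule sed_eq_0[OF assms(1,2)])
  obtain \<tau> where \<tau>: "\<tau> \<in> K" "x \<in> \<tau>" using assms(3) by (auto simp: open_star_def)
  then show "x \<in> P" using Union_K by auto
  fix Q assume Q: "Q face_of P" "x \<in> Q"
  have "\<tau> \<subseteq> P" using \<tau> Union_K by auto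
  then have "(Q \<inter> \<tau>) face_of \<tau>"
    using face_of_slice[OF Q(1) convex_simplex[OF \<tau>(1)]] by (simp add: Int_absorb1)
  then have "Q \<inter> \<tau> \<in> K" by (rule face_in_K[OF \<tau>(1)])
  then show "v \<in> Q" using open_star_simplex[OF assms(3)] Q \<tau> by blast
qed

lemma vertex_sphere_subset: "vertex_sphere K v \<subseteq> open_star K v"
proof
  fix x assume "x \<in> vertex_sphere K v"
  then obtain w where x: "x \<in> dual_cell K (closed_segment v w)"
    by (auto simp: vertex_sphere_def)
  then have "v \<in> \<tau>" if "\<tau> \<in> K" "x \<in> \<tau>" for \<tau>
    using simplex_meeting_dual_cell[OF x that(2,1)] by auto
  moreover have "x \<in> P" using dual_cell_subset_support[of "closed_segment v w"] x by auto
  ultimately show "x \<in> open_star K v" unfolding open_star_def Union_K by auto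
qed

lemma compact_vertex_sphere: "compact (vertex_sphere K v)"
proof -
  have "{dual_cell K (closed_segment v w) | w. w \<noteq> v \<and> closed_segment v w \<in> K} \<subseteq> dual_cell K ` K"
    by auto
  then show ?thesis
    unfolding vertex_sphere_def using finite_K compact_dual_cell
    by (intro compact_Union) (auto intro: finite_subset)
qed

lemma lattice_point_in_facet:
  assumes "v \<in> P" "v \<in> int_lattice"
  obtains \<tau> where "\<tau> \<in> facets K" "v \<in> vertices \<tau>"
proof -
  obtain \<rho> where \<rho>: "\<rho> \<in> K" "v \<in> \<rho>" using assms(1) Union_K by auto
  obtain \<tau> where "\<tau> \<in> facets K" "\<rho> \<subseteq> \<tau>" using subset_facet[OF \<rho>(1)] .
  then show ?thesis using that lattice_point_facet assms(2) \<rho>(2) by blast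
qed

lemma vertex_sphere_nonempty:
  assumes "v \<in> P" "v \<in> int_lattice"
  shows "vertex_sphere K v \<noteq> {}"
proof -
  obtain \<tau> where \<tau>: "\<tau> \<in> facets K" "v \<in> vertices \<tau>" using lattice_point_in_facet[OF assms] .
  have K: "\<tau> \<in> K" using \<tau>(1) facets_subset by auto
  have "vertices \<tau> \<noteq> {v}" using card_vertices_facet[OF \<tau>(1)] by auto
  then obtain w where w: "w \<in> vertices \<tau>" "w \<noteq> v" using \<tau>(2) by auto
  have e: "closed_segment v w \<in> K" using edge_in_K[OF K \<tau>(2) w(1)] .
  have "barycenter (closed_segment v w) \<in> vertex_sphere K v"
    unfolding vertex_sphere_def using barycenter_in_dual_cell[OF e subset_refl] e w(2) by blast
  then show ?thesis by blast
qed

lemma edge_vertices: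
  assumes "closed_segment a b \<in> K" "closed_segment a b \<subseteq> \<tau>" "\<tau> \<in> facets K"
  shows "a \<in> vertices \<tau>" "b \<in> vertices \<tau>"
proof -
  have "a \<in> int_lattice" "b \<in> int_lattice"
    using extreme_points_int[OF assms(1)] extreme_point_of_segment by auto
  then show "a \<in> vertices \<tau>" "b \<in> vertices \<tau>"
    using lattice_point_facet[OF assms(3)] assms(2) by auto
qed

text \<open>
  A cell meeting the open star of \<open>v\<close> in the copy \<open>u = 0\<close> belongs to an edge \<open>ab\<close> with different
  signs that lies in a common facet with \<open>v\<close>. Neighbours of \<open>v\<close> have equal signs, so one of \<open>a\<close>,
  \<open>b\<close> is \<open>v\<close>.
\<close>

lemma T_hypersurface_in_open_star:
  assumes P: "convex P" and v: "v \<in> interior P" "v \<in> int_lattice" and iso: "isolated K \<epsilon> v"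
  shows "T_hypersurface P K \<epsilon> \<inter> locus_proj P ` ({0} \<times> open_star K v)
    = locus_proj P ` ({0} \<times> vertex_sphere K v)"
proof (rule subset_antisym; rule subsetI)
  fix y assume y: "y \<in> T_hypersurface P K \<epsilon> \<inter> locus_proj P ` ({0} \<times> open_star K v)"
  then obtain u a b x where cell: "a \<noteq> b" "closed_segment a b \<in> K" "pair2 (a - b) u + \<epsilon> a + \<epsilon> b = 1"
    and x: "x \<in> dual_cell K (closed_segment a b)" and yx: "y = locus_proj P (u, x)"
    by (auto elim: T_hypersurface_cases)
  obtain x' where x': "x' \<in> open_star K v" "y = locus_proj P (0, x')" using y by auto
  have "x' \<in> P" using x'(1) Union_K by (auto simp: open_star_def)
  then have "x = x'" "u = 0"
    using locus_proj_eq_imp[of x' P 0 u x] x' yx sed_open_star[OF P v(1) x'(1)] by auto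
  then have xs: "x \<in> open_star K v" using x' by simp
  have sum: "\<epsilon> a + \<epsilon> b = 1" using cell(3) \<open>u = 0\<close> by (simp add: pair2_def)
  obtain \<rho> where \<rho>: "\<rho> \<in> K" "closed_segment a b \<subseteq> \<rho>" "x \<in> \<rho>"
    using dual_cell_in_simplex[OF x] by auto
  obtain \<tau> where \<tau>: "\<tau> \<in> facets K" "\<rho> \<subseteq> \<tau>" using subset_facet[OF \<rho>(1)] .
  have "v \<in> vertices \<tau>"
    using open_star_simplex[OF xs \<rho>(1,3)] \<tau> lattice_point_facet[OF \<tau>(1)] v(2) by auto
  then have "vertices \<tau> \<subseteq> star_vertices K v" using \<tau>(1) by (auto simp: star_vertices_def)
  then have "a \<in> star_vertices K v" "b \<in> star_vertices K v"
    using edge_vertices[OF cell(2) _ \<tau>(1)] \<rho>(2) \<tau>(2) by auto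
  then have "a \<noteq> v \<Longrightarrow> \<epsilon> a = 0" "b \<noteq> v \<Longrightarrow> \<epsilon> b = 0"
    using iso unfolding isolated_def by blast+
  with sum have "a = v \<or> b = v" by (metis add.right_neutral zero_neq_one)
  then obtain w where w: "w \<noteq> v" "closed_segment a b = closed_segment v w"
    using cell(1) closed_segment_commute by metis
  have "x \<in> vertex_sphere K v"
    using x cell(2) w(1) unfolding w(2) vertex_sphere_def by blast
  then show "y \<in> locus_proj P ` ({0} \<times> vertex_sphere K v)"
    using yx \<open>u = 0\<close> by auto
next
  fix y assume "y \<in> locus_proj P ` ({0} \<times> vertex_sphere K v)"
  then obtain x where x: "x \<in> vertex_sphere K v" "y = locus_proj P (0, x)" by auto
  then obtain w where w: "w \<noteq> v" "closed_segment v w \<in> K" "x \<in> dual_cell K (closed_segment v w)"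
    by (auto simp: vertex_sphere_def)
  obtain \<tau> where \<tau>: "\<tau> \<in> facets K" "closed_segment v w \<subseteq> \<tau>" using subset_facet[OF w(2)] .
  have "w \<in> star_vertices K v"
    using edge_vertices[OF w(2) \<tau>(2,1)] \<tau>(1) by (auto simp: star_vertices_def)
  then have "pair2 (v - w) 0 + \<epsilon> v + \<epsilon> w = 1"
    using iso w(1) by (simp add: isolated_def pair2_def)
  then have "y \<in> T_hypersurface P K \<epsilon>"
    using T_hypersurface_cell[of v w 0 \<epsilon>] w x(2) by auto
  then show "y \<in> T_hypersurface P K \<epsilon> \<inter> locus_proj P ` ({0} \<times> open_star K v)"
    using x vertex_sphere_subset by auto
qed

text \<open>
  The vertex spheres of isolated points are clopen by the previous lemma: they are compact, and
  they are cut out by the open stars. If two of them met, the two points would be adjacent,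
  which their signs exclude.
\<close>

lemma isolated_le_b0:
  assumes P: "convex P"
  shows "card {v \<in> interior P \<inter> int_lattice. isolated K \<epsilon> v} \<le> b0_T_hypersurface P K \<epsilon>"
proof -
  let ?T = "T_hypersurface P K \<epsilon>"
  let ?X = "subtopology (real_locus P) ?T"
  let ?A = "\<lambda>v. locus_proj P ` ({0} \<times> vertex_sphere K v)"
  let ?B = "\<lambda>v. locus_proj P ` ({0} \<times> open_star K v)"
  have "card {v \<in> interior P \<inter> int_lattice. isolated K \<epsilon> v} \<le> b0 ?X"
  proof (rule card_clopen_le_b0[where A = ?A])
    show "finite (connected_components_of ?X)" by (rule components_T_hypersurface)
    fix v assume "v \<in> {v \<in> interior P \<inter> int_lattice. isolated K \<epsilon> v}"
    then have v: "v \<in> interior P" "v \<in> int_lattice" "isolated K \<epsilon> v" by auto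
    note AB = T_hypersurface_in_open_star[OF P v]
    note sed = sed_open_star[OF P v(1)]
    have "openin (real_locus P) (?B v)"
      using openin_locus_proj[OF openin_open_star sed] .
    then show "openin ?X (?A v)"
      unfolding AB[symmetric] by (auto simp: openin_subtopology)
    have sub: "vertex_sphere K v \<subseteq> P"
      using vertex_sphere_subset[of v] Union_K by (auto simp: open_star_def)
    then have "closedin (top_of_set P) (vertex_sphere K v)"
      using compact_vertex_sphere by (simp add: closed_subset compact_imp_closed)
    then have "closedin (real_locus P) (?A v)"
      by (rule closedin_locus_proj) (use sed vertex_sphere_subset in blast)
    then show "closedin ?X (?A v)"
      using AB by (auto simp: closedin_subtopology)
    show "?A v \<noteq> {}"
      using vertex_sphere_nonempty v(1,2) interior_subset by blast
    fix w assume "w \<in> {v \<in> interior P \<inter> int_lattice. isolated K \<epsilon> v}" and vw: "v \<noteq> w"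
    then have w: "w \<in> interior P" "w \<in> int_lattice" "isolated K \<epsilon> w" by auto
    show "?A v \<inter> ?A w = {}"
    proof (rule ccontr)
      assume "\<not> ?thesis"
      then obtain x x' where xx': "x \<in> vertex_sphere K v" "x' \<in> vertex_sphere K w"
        "locus_proj P (0, x) = locus_proj P (0, x')" by auto
      then have "x' = x" using locus_proj_eq_imp(1)[OF _ xx'(3)] sub by auto
      then have star: "x \<in> open_star K v" "x \<in> open_star K w"
        using xx' vertex_sphere_subset by auto
      obtain \<tau> where \<tau>: "\<tau> \<in> facets K" "x \<in> \<tau>" "v \<in> \<tau>" using open_star_facet[OF star(1)] .
      have "w \<in> \<tau>" using open_star_simplex[OF star(2) _ \<tau>(2)] \<tau>(1) facets_subset by auto
      then have "v \<in> vertices \<tau>" "w \<in> vertices \<tau>"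
        using lattice_point_facet[OF \<tau>(1)] \<tau>(3) v(2) w(2) by auto
      then have "w \<in> star_vertices K v - {v}" using \<tau>(1) vw by (auto simp: star_vertices_def)
      then show False using v(3) w(3) by (auto simp: isolated_def)
    qed
  qed
  then show ?thesis by (simp add: b0_T_hypersurface_def)
qed

lemma card_star_vertices:
  "card (star_vertices K v) \<le> (CARD('n) + 1) * card {\<tau> \<in> facets K. v \<in> vertices \<tau>}"
proof -
  let ?F = "{\<tau> \<in> facets K. v \<in> vertices \<tau>}"
  have "star_vertices K v = (\<Union>\<tau>\<in>?F. vertices \<tau>)" by (auto simp: star_vertices_def)
  also have "card \<dots> \<le> (\<Sum>\<tau>\<in>?F. card (vertices \<tau>))"
    using finite_facets by (intro card_UN_le) auto
  also have "\<dots> = (CARD('n) + 1) * card ?F"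
    using card_vertices_facet by simp
  finally show ?thesis .
qed

text \<open>
  Double counting: each facet has \<open>CARD('n) + 1\<close> vertices.
\<close>

lemma sum_facets_at_vertices:
  assumes "finite L"
  shows "(\<Sum>v\<in>L. card {\<tau> \<in> facets K. v \<in> vertices \<tau>}) \<le> (CARD('n) + 1) * card (facets K)"
proof -
  have "(\<Sum>v\<in>L. card {\<tau> \<in> facets K. v \<in> vertices \<tau>}) = (\<Sum>v\<in>L. \<Sum>\<tau>\<in>facets K. of_bool (v \<in> vertices \<tau>))"
    using finite_facets by (simp add: Int_def)
  also have "\<dots> = (\<Sum>\<tau>\<in>facets K. card (L \<inter> vertices \<tau>))"
    using assms by (subst sum.swap) (simp add: Int_def)
  also have "\<dots> \<le> (\<Sum>\<tau>\<in>facets K. card (vertices \<tau>))"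
    using simplex_hull_vertices(1) facets_subset by (intro sum_mono card_mono) auto
  also have "\<dots> = (CARD('n) + 1) * card (facets K)"
    using card_vertices_facet by simp
  finally show ?thesis .
qed

lemma star_vertices_subset: "star_vertices K v \<subseteq> P \<inter> int_lattice"
proof -
  have "vertices \<tau> \<subseteq> P \<inter> int_lattice" if "\<tau> \<in> facets K" for \<tau>
  proof -
    have "\<tau> \<in> K" using that facets_subset by auto
    then show ?thesis using vertices_subset[of \<tau>] simplex_hull_vertices(4)[of \<tau>] Union_K by auto
  qed
  then show ?thesis by (auto simp: star_vertices_def)
qed

end

section \<open>Counting lattice points\<close>

text \<open>
  A ball of radius \<open>r\<close> inside \<open>P\<close> becomes a ball of radius \<open>d r\<close>, which contains a cubical grid of
  lattice points with about \<open>d r / CARD('n)\<close> points in each direction. Finiteness is asked for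
  because \<open>card\<close> is 0 on infinite sets.
\<close>

lemma many_interior_lattice_points:
  fixes P :: "(real ^ 'n) set"
  assumes "interior P \<noteq> {}"
  obtains c d0 where "c > 0"
    "\<And>d. d \<ge> d0 \<Longrightarrow> finite (interior (dilate d P) \<inter> int_lattice) \<Longrightarrow>
       c * real d ^ CARD('n) \<le> real (card (interior (dilate d P) \<inter> int_lattice))"
proof -
  let ?N = "CARD('n)" and ?n = "real CARD('n)"
  obtain a r where r: "r > 0" "ball a r \<subseteq> P" using assms by (auto simp: mem_interior)
  define c where "c = (r / (2 * ?n)) ^ ?N"
  define d0 where "d0 = nat \<lceil>2 * ?n / r\<rceil> + 1"
  have "c * real d ^ ?N \<le> real (card (interior (dilate d P) \<inter> int_lattice))"
    if d: "d \<ge> d0" and fin: "finite (interior (dilate d P) \<inter> int_lattice)" for d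
  proof -
    have d1: "d \<ge> 1" using d by (simp add: d0_def)
    have "2 * ?n / r \<le> real d0" by (simp add: d0_def) linarith
    then have "2 * ?n / r \<le> d" using d by linarith
    \<comment> \<open>The grid has \<open>m\<close> points per direction. Being within \<open>m\<close> of the centre in each of the \<open>?n\<close>
      coordinates keeps it in the ball as long as \<open>?n * m \<le> d * r\<close>.\<close>
    define y where "y = d * r / ?n"
    have y: "d * r = ?n * y" "d * r / (2 * ?n) = y / 2" by (simp_all add: y_def)
    have "2 \<le> y" using \<open>2 * ?n / r \<le> d\<close> r(1) by (simp add: y_def field_simps)
    define m where "m = nat \<lfloor>y\<rfloor>"
    have "0 \<le> \<lfloor>y\<rfloor>" using \<open>2 \<le> y\<close> by linarith
    then have "real m = real_of_int \<lfloor>y\<rfloor>" by (simp add: m_def)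
    then have m: "real m \<le> y" "y / 2 \<le> m" using \<open>2 \<le> y\<close> by linarith+
    let ?F = "PiE (UNIV :: 'n set) (\<lambda>_. {..<m})"
    let ?g = "\<lambda>k :: 'n \<Rightarrow> nat. (\<chi> i. real_of_int \<lceil>d * a $ i\<rceil> + real (k i)) :: real ^ 'n"
    have "ball (real d *\<^sub>R a) (d * r) \<subseteq> dilate d P"
    proof
      fix y assume y: "y \<in> ball (real d *\<^sub>R a) (d * r)"
      have "a - (1 / d) *\<^sub>R y = (1 / d) *\<^sub>R (real d *\<^sub>R a - y)"
        using d1 by (simp add: scaleR_right_diff_distrib)
      then have "norm (a - (1 / d) *\<^sub>R y) = norm (real d *\<^sub>R a - y) / d" using d1 by simp
      also have "\<dots> < r" using y d1 by (simp add: dist_norm field_simps)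
      finally have "(1 / d) *\<^sub>R y \<in> P" using r(2) by (auto simp: dist_norm)
      then show "y \<in> dilate d P"
        unfolding dilate_def using d1 by (intro image_eqI[of _ _ "(1 / d) *\<^sub>R y"]) auto
    qed
    then have ball: "ball (real d *\<^sub>R a) (d * r) \<subseteq> interior (dilate d P)"
      by (rule interior_maximal) simp
    have "?g ` ?F \<subseteq> interior (dilate d P) \<inter> int_lattice"
    proof
      fix x assume "x \<in> ?g ` ?F"
      then obtain k where k: "k \<in> ?F" "x = ?g k" by auto
      have "\<bar>(real d *\<^sub>R a - x) $ i\<bar> < m" for i
      proof -
        have "k i < m" using k by auto
        then have "real (k i) \<le> real m - 1" by linarith
        then show ?thesis
          using ceiling_correct[of "d * a $ i"] k(2) by (simp add: abs_less_iff) linarith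
      qed
      then have "(\<Sum>i\<in>UNIV. \<bar>(real d *\<^sub>R a - x) $ i\<bar>) < (\<Sum>i\<in>(UNIV :: 'n set). real m)"
        by (intro sum_strict_mono) auto
      then have "norm (real d *\<^sub>R a - x) < ?n * real m"
        using norm_le_l1_cart[of "real d *\<^sub>R a - x"] by simp
      also have "\<dots> \<le> d * r" unfolding y(1) using m(1) by (intro mult_left_mono) auto
      finally have "x \<in> interior (dilate d P)" using ball by (auto simp: dist_norm)
      moreover have "x \<in> int_lattice" using k(2) by (simp add: int_lattice_def)
      ultimately show "x \<in> interior (dilate d P) \<inter> int_lattice" by simp
    qed
    moreover have "inj ?g"
    proof (rule injI, rule ext)
      fix k l i assume "?g k = ?g l"
      then have "?g k $ i = ?g l $ i" by (rule arg_cong)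
      then show "k i = l i" by simp
    qed
    ultimately have "card ?F \<le> card (interior (dilate d P) \<inter> int_lattice)"
      using fin by (intro card_inj_on_le[of ?g]) (auto intro: inj_on_subset)
    moreover have "card ?F = m ^ ?N" by (simp add: card_PiE)
    moreover have "c * real d ^ ?N = (d * r / (2 * ?n)) ^ ?N"
      by (simp add: c_def power_mult_distrib power_divide)
    moreover have "(d * r / (2 * ?n)) ^ ?N \<le> real m ^ ?N"
      unfolding y(2) using m(2) \<open>2 \<le> y\<close> by (intro power_mono) auto
    ultimately show ?thesis by (metis of_nat_le_iff of_nat_power order_trans)
  qed
  moreover have "c > 0" using r(1) by (simp add: c_def)
  ultimately show ?thesis using that by blast
qed

section \<open>The expected number of isolated points\<close>

text \<open>
  The bound is linear in \<open>t\<close>, so it can be summed over lattice points \<open>v\<close> when only the sum of the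
  numbers \<open>t(v)\<close> of facets at \<open>v\<close> is under control.
\<close>

lemma power_ge_linear:
  fixes q :: real
  assumes "0 < q" "q \<le> 1" "T > 0"
  shows "q ^ T * (1 - real t / real T) \<le> q ^ t"
proof (cases "t \<le> T")
  case True
  have "q ^ T * (1 - real t / real T) \<le> q ^ T * 1"
    using assms by (intro mult_left_mono) auto
  also have "\<dots> \<le> q ^ t" using True assms by (simp add: power_decreasing)
  finally show ?thesis .
next
  case False
  then have "1 - real t / real T \<le> 0" using assms(3) by simp
  then have "q ^ T * (1 - real t / real T) \<le> 0"
    using assms by (intro mult_nonneg_nonpos) auto
  also have "0 \<le> q ^ t" using assms by simp
  finally show ?thesis .
qed

text \<open>
  Under the product law it suffices to bound the expectation from below for every fixed value of the
  first component.
\<close>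

lemma expectation_pair_pmf_ge:
  fixes f :: "'a \<times> 'b \<Rightarrow> real"
  assumes bound: "\<And>x y. x \<in> set_pmf p \<Longrightarrow> y \<in> set_pmf q \<Longrightarrow> 0 \<le> f (x, y) \<and> f (x, y) \<le> B"
    and ge: "\<And>x. x \<in> set_pmf p \<Longrightarrow> c \<le> measure_pmf.expectation q (\<lambda>y. f (x, y))"
  shows "c \<le> measure_pmf.expectation (pair_pmf p q) f"
proof -
  have int: "integrable (pair_pmf p q) f"
    by (rule measure_pmf.integrable_const_bound[where B = B])
       (use bound in \<open>auto simp: AE_measure_pmf_iff\<close>)
  have "ennreal c \<le> (\<integral>\<^sup>+ y. ennreal (f (x, y)) \<partial>q)" if x: "x \<in> set_pmf p" for x
  proof -
    have "integrable q (\<lambda>y. f (x, y))"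
      by (rule measure_pmf.integrable_const_bound[where B = B])
         (use bound x in \<open>auto simp: AE_measure_pmf_iff\<close>)
    then have "(\<integral>\<^sup>+ y. ennreal (f (x, y)) \<partial>q) = ennreal (measure_pmf.expectation q (\<lambda>y. f (x, y)))"
      by (rule nn_integral_eq_integral) (use bound x in \<open>auto simp: AE_measure_pmf_iff\<close>)
    then show ?thesis using ge[OF x] by (simp add: ennreal_leI)
  qed
  then have "(\<integral>\<^sup>+ x. ennreal c \<partial>p) \<le> (\<integral>\<^sup>+ x. \<integral>\<^sup>+ y. ennreal (f (x, y)) \<partial>q \<partial>p)"
    by (intro nn_integral_mono_AE) (simp add: AE_measure_pmf_iff)
  also have "\<dots> = (\<integral>\<^sup>+ z. ennreal (f z) \<partial>pair_pmf p q)"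
    by (simp add: nn_integral_pair_pmf')
  also have "\<dots> = ennreal (measure_pmf.expectation (pair_pmf p q) f)"
    using int by (rule nn_integral_eq_integral) (use bound in \<open>auto simp: AE_measure_pmf_iff\<close>)
  finally have "ennreal c \<le> ennreal (measure_pmf.expectation (pair_pmf p q) f)" by simp
  moreover have "0 \<le> measure_pmf.expectation (pair_pmf p q) f"
    by (rule integral_nonneg_AE) (use bound in \<open>auto simp: AE_measure_pmf_iff\<close>)
  ultimately show ?thesis by (simp add: ennreal_le_iff)
qed

text \<open>
  The probability that uniform signs take prescribed values on \<open>S\<close>.
\<close>

lemma card_fixed_signs:
  fixes v :: 'a
  assumes L: "finite L" and S: "S \<subseteq> L" "v \<in> S"
  shows "real (card {\<epsilon> \<in> L \<rightarrow>\<^sub>E (UNIV :: bit set). \<epsilon> v = 1 \<and> (\<forall>w\<in>S - {v}. \<epsilon> w = 0)}) /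
      real (card (L \<rightarrow>\<^sub>E (UNIV :: bit set))) = (1 / 2) ^ card S"
proof -
  have fin: "finite S" using L S finite_subset by blast
  have bit: "card (UNIV :: bit set) = 2" by (simp add: UNIV_bit)
  let ?B = "\<lambda>w. if w = v then {1} else if w \<in> S then {0} else (UNIV :: bit set)"
  have "{\<epsilon> \<in> L \<rightarrow>\<^sub>E (UNIV :: bit set). \<epsilon> v = 1 \<and> (\<forall>w\<in>S - {v}. \<epsilon> w = 0)} = PiE L ?B"
  proof (rule set_eqI)
    fix \<epsilon> :: "'a \<Rightarrow> bit"
    have "\<epsilon> w \<in> ?B w \<longleftrightarrow> (w = v \<longrightarrow> \<epsilon> w = 1) \<and> (w \<in> S - {v} \<longrightarrow> \<epsilon> w = 0)" for w by simp
    then have "(\<forall>w\<in>L. \<epsilon> w \<in> ?B w) \<longleftrightarrow> \<epsilon> v = 1 \<and> (\<forall>w\<in>S - {v}. \<epsilon> w = 0)"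
      using S by blast
    then show "\<epsilon> \<in> {\<epsilon> \<in> L \<rightarrow>\<^sub>E UNIV. \<epsilon> v = 1 \<and> (\<forall>w\<in>S - {v}. \<epsilon> w = 0)} \<longleftrightarrow> \<epsilon> \<in> PiE L ?B"
      unfolding PiE_iff mem_Collect_eq by blast
  qed
  moreover have "card (PiE L ?B) = (\<Prod>w\<in>L. card (?B w))" using L by (rule card_PiE)
  moreover have "(\<Prod>w\<in>L. card (?B w)) = (\<Prod>w\<in>L - S. card (?B w)) * (\<Prod>w\<in>S. card (?B w))"
    using prod.subset_diff[OF S(1) L] .
  moreover have "(\<Prod>w\<in>S. card (?B w)) = 1" by (intro prod.neutral) auto
  moreover have "(\<Prod>w\<in>L - S. card (?B w)) = (\<Prod>w\<in>L - S. 2)"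
    using S bit by (intro prod.cong) auto
  ultimately have num: "card {\<epsilon> \<in> L \<rightarrow>\<^sub>E (UNIV :: bit set). \<epsilon> v = 1 \<and> (\<forall>w\<in>S - {v}. \<epsilon> w = 0)}
      = 2 ^ card (L - S)" by simp
  have "card (L \<rightarrow>\<^sub>E (UNIV :: bit set)) = 2 ^ card L" using L bit by (simp add: card_PiE)
  moreover have "card L = card S + card (L - S)"
    using L S fin by (simp add: card_Diff_subset card_mono)
  ultimately show ?thesis unfolding num by (simp add: power_add power_divide)
qed

context unimodular_triangulation
begin

lemma finite_lattice_points: "finite (P \<inter> int_lattice)"
proof -
  have "P \<inter> int_lattice \<subseteq> \<Union> (vertices ` facets K)"
    using lattice_point_in_facet by blast
  moreover have "finite (\<Union> (vertices ` facets K))"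
    using finite_facets facets_subset simplex_hull_vertices(1) by auto
  ultimately show ?thesis by (rule finite_subset)
qed

lemma expectation_ge_sum_stars:
  assumes "convex P"
  shows "(\<Sum>v\<in>interior P \<inter> int_lattice. (1 / 2) ^ card (star_vertices K v))
    \<le> measure_pmf.expectation (uniform_signs P) (\<lambda>\<epsilon>. real (b0_T_hypersurface P K \<epsilon>))"
proof -
  let ?L = "P \<inter> int_lattice" and ?I = "interior P \<inter> int_lattice"
  let ?\<Omega> = "?L \<rightarrow>\<^sub>E (UNIV :: bit set)"
  have I: "?I \<subseteq> ?L" using interior_subset by auto
  have finI: "finite ?I" using I finite_lattice_points by (rule finite_subset)
  have \<Omega>: "finite ?\<Omega>" "?\<Omega> \<noteq> {}"
    using finite_lattice_points by (auto simp: finite_PiE PiE_eq_empty_iff)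
  have "(\<Sum>v\<in>?I. (1 / 2) ^ card (star_vertices K v))
      = (\<Sum>v\<in>?I. real (card {\<epsilon> \<in> ?\<Omega>. isolated K \<epsilon> v}) / real (card ?\<Omega>))"
  proof (rule sum.cong[OF refl])
    fix v assume v: "v \<in> ?I"
    obtain \<tau> where "\<tau> \<in> facets K" "v \<in> vertices \<tau>"
      using lattice_point_in_facet[of v] v I by auto
    then have "v \<in> star_vertices K v" by (auto simp: star_vertices_def)
    from card_fixed_signs[OF finite_lattice_points star_vertices_subset this]
    show "(1 / 2) ^ card (star_vertices K v) = real (card {\<epsilon> \<in> ?\<Omega>. isolated K \<epsilon> v}) / real (card ?\<Omega>)"
      by (simp add: isolated_def)
  qed
  also have "\<dots> = (\<Sum>v\<in>?I. \<Sum>\<epsilon>\<in>?\<Omega>. of_bool (isolated K \<epsilon> v)) / real (card ?\<Omega>)"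
    using \<Omega>(1) by (simp add: sum_divide_distrib Int_def)
  also have "\<dots> = (\<Sum>\<epsilon>\<in>?\<Omega>. real (card {v \<in> ?I. isolated K \<epsilon> v})) / real (card ?\<Omega>)"
    using finI by (subst sum.swap) (simp add: Int_def)
  also have "\<dots> \<le> (\<Sum>\<epsilon>\<in>?\<Omega>. real (b0_T_hypersurface P K \<epsilon>)) / real (card ?\<Omega>)"
    using isolated_le_b0[OF assms] by (intro divide_right_mono sum_mono) auto
  also have "\<dots> = measure_pmf.expectation (uniform_signs P) (\<lambda>\<epsilon>. real (b0_T_hypersurface P K \<epsilon>))"
    unfolding uniform_signs_def using \<Omega> by (simp add: integral_pmf_of_set)
  finally show ?thesis .
qed

text \<open>
  The number \<open>T\<close> is a threshold for the number of facets at a lattice point, to be chosen large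
  compared with its average. The loss \<open>(N + 1) F / T\<close>, with \<open>F\<close> the number of facets, is then
  smaller than the number of interior lattice points.
\<close>

lemma expectation_ge:
  fixes T :: nat
  assumes "convex P" "T > 0"
  shows "(1 / 2) ^ ((CARD('n) + 1) * T) *
      (real (card (interior P \<inter> int_lattice)) - (CARD('n) + 1) * real (card (facets K)) / T)
    \<le> measure_pmf.expectation (uniform_signs P) (\<lambda>\<epsilon>. real (b0_T_hypersurface P K \<epsilon>))"
proof -
  let ?I = "interior P \<inter> int_lattice" and ?D = "CARD('n) + 1"
  let ?t = "\<lambda>v. card {\<tau> \<in> facets K. v \<in> vertices \<tau>}"
  let ?q = "(1 / 2) ^ ?D :: real"
  have finI: "finite ?I"
    using interior_subset finite_lattice_points by (rule_tac finite_subset[of _ "P \<inter> int_lattice"]) auto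
  have q: "0 < ?q" "?q \<le> 1" by (intro zero_less_power power_le_one; simp)+
  have "(\<Sum>v\<in>?I. real (?t v)) \<le> real (?D * card (facets K))"
    using sum_facets_at_vertices[OF finI] by (simp only: of_nat_sum[symmetric] of_nat_le_iff)
  then have "(\<Sum>v\<in>?I. real (?t v)) \<le> ?D * real (card (facets K))"
    by (simp only: of_nat_mult)
  then have "real (card ?I) - ?D * real (card (facets K)) / T
      \<le> real (card ?I) - (\<Sum>v\<in>?I. real (?t v)) / T"
    by (intro diff_left_mono divide_right_mono) auto
  also have "\<dots> = (\<Sum>v\<in>?I. 1 - real (?t v) / T)"
    by (simp add: sum_subtractf sum_divide_distrib)
  finally have "?q ^ T * (real (card ?I) - ?D * real (card (facets K)) / T)
      \<le> ?q ^ T * (\<Sum>v\<in>?I. 1 - real (?t v) / T)"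
    using q by (intro mult_left_mono) auto
  also have "\<dots> = (\<Sum>v\<in>?I. ?q ^ T * (1 - real (?t v) / T))" by (simp add: sum_distrib_left)
  also have "\<dots> \<le> (\<Sum>v\<in>?I. (1 / 2) ^ card (star_vertices K v))"
  proof (rule sum_mono)
    fix v
    have "?q ^ T * (1 - real (?t v) / T) \<le> ?q ^ ?t v" using power_ge_linear[OF q assms(2)] .
    also have "\<dots> = (1 / 2) ^ (?D * ?t v)" by (simp only: power_mult)
    also have "\<dots> \<le> (1 / 2) ^ card (star_vertices K v)"
      using card_star_vertices by (intro power_decreasing) auto
    finally show "?q ^ T * (1 - real (?t v) / T) \<le> (1 / 2) ^ card (star_vertices K v)" .
  qed
  also note expectation_ge_sum_stars[OF assms(1)]
  finally show ?thesis by (simp only: power_mult)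
qed

end

section \<open>The asymptotic order\<close>

lemma measure_dilate:
  "measure lebesgue (dilate d P) = real d ^ CARD('n) * measure lebesgue P" for P :: "(real ^ 'n) set"
  using measure_lebesgue_affine[of "real d" 0 P] by (simp add: dilate_def)

lemma card_facets_dilate:
  fixes P :: "(real ^ 'n) set"
  assumes "primitive_triangulation (dilate d P) K"
  shows "real (card (facets K)) = fact CARD('n) * measure lebesgue P * real d ^ CARD('n)"
proof -
  interpret unimodular_triangulation "dilate d P" K by unfold_locales fact
  show ?thesis using card_facets by (simp add: measure_dilate)
qed

theorem theorem5p18:
  fixes P :: "(real ^ 'n) set"
    and n :: nat
    and \<kappa> :: "nat \<Rightarrow> (real ^ 'n) set set pmf"
  assumes "CARD('n) = n + 1" and "n \<ge> 1"
    and "smooth_polytope P"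
    and "\<And>d K. d \<ge> 1 \<Longrightarrow> K \<in> set_pmf (\<kappa> d) \<Longrightarrow> primitive_triangulation (dilate d P) K"
  shows "(\<lambda>d. expected_b0 (dilate d P) (\<kappa> d)) \<in> \<Theta>(\<lambda>d. real d ^ (n + 1))"
proof -
  let ?N = "CARD('n)" and ?E = "\<lambda>d. expected_b0 (dilate d P) (\<kappa> d)"
  obtain V where V: "finite V" "P = convex hull V"
    using assms(3) by (auto simp: smooth_polytope_def lattice_polytope_def)
  then have P: "convex P" by simp
  then have convex: "convex (dilate d P)" for d
    unfolding dilate_def by (rule convex_scaling)
  have "interior P \<noteq> {}"
  proof -
    have dim: "aff_dim P = int DIM(real ^ 'n)" using assms(3) by (simp add: smooth_polytope_def)
    then have "P \<noteq> {}" using aff_dim_empty by force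
    then show ?thesis
      using interior_rel_interior_gen[of P] rel_interior_eq_empty[OF P] dim by simp
  qed
  then obtain c d0 where c: "c > 0"
    "\<And>d. d \<ge> d0 \<Longrightarrow> finite (interior (dilate d P) \<inter> int_lattice) \<Longrightarrow>
       c * real d ^ ?N \<le> real (card (interior (dilate d P) \<inter> int_lattice))"
    using many_interior_lattice_points[of P] by blast
  define A where "A = fact ?N * measure lebesgue P"
  have A: "A \<ge> 0" by (simp add: A_def)
  have upper: "0 \<le> real (b0_T_hypersurface (dilate d P) K \<epsilon>) \<and>
      real (b0_T_hypersurface (dilate d P) K \<epsilon>) \<le> CARD(bit ^ 'n) * A * real d ^ ?N"
    if "d \<ge> 1" "K \<in> set_pmf (\<kappa> d)" for d K \<epsilon>
  proof -
    interpret unimodular_triangulation "dilate d P" K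
      by unfold_locales (rule assms(4)[OF that])
    have "real (b0_T_hypersurface (dilate d P) K \<epsilon>) \<le> real (CARD(bit ^ 'n) * card (facets K))"
      using b0_le_facets by (simp only: of_nat_le_iff)
    then show ?thesis
      using card_facets_dilate[OF assms(4)[OF that]] by (simp add: A_def mult.assoc)
  qed
  \<comment> \<open>With this threshold, the loss in \<open>expectation_ge\<close> is at most half the number of interior
    lattice points.\<close>
  obtain T :: nat where T: "T > 0" "(?N + 1) * A / T \<le> c / 2"
  proof -
    let ?x = "2 * (?N + 1) * A / c"
    have "?x \<le> real (nat \<lceil>?x\<rceil> + 1)" by linarith
    then have "(?N + 1) * A / real (nat \<lceil>?x\<rceil> + 1) \<le> c / 2"
      using c(1) by (simp add: field_simps)
    then show ?thesis using that[of "nat \<lceil>?x\<rceil> + 1"] by simp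
  qed
  define b where "b = (1 / 2) ^ ((?N + 1) * T) * (c / 2)"
  have b: "b > 0" using c(1) by (simp add: b_def)
  have lower: "b * real d ^ ?N \<le>
      measure_pmf.expectation (uniform_signs (dilate d P)) (\<lambda>\<epsilon>. real (b0_T_hypersurface (dilate d P) K \<epsilon>))"
    if d: "d \<ge> 1" "d \<ge> d0" and K: "K \<in> set_pmf (\<kappa> d)" for d K
  proof -
    interpret unimodular_triangulation "dilate d P" K
      by unfold_locales (rule assms(4)[OF d(1) K])
    have "finite (interior (dilate d P) \<inter> int_lattice)"
      using interior_subset finite_lattice_points
      by (rule_tac finite_subset[of _ "dilate d P \<inter> int_lattice"]) auto
    then have "c * real d ^ ?N \<le> real (card (interior (dilate d P) \<inter> int_lattice))"
      by (rule c(2)[OF d(2)])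
    moreover have "(?N + 1) * real (card (facets K)) / T \<le> c / 2 * real d ^ ?N"
      using mult_right_mono[OF T(2), of "real d ^ ?N"]
        card_facets_dilate[OF assms(4)[OF d(1) K]] by (simp add: A_def mult.assoc)
    ultimately have "c / 2 * real d ^ ?N \<le>
        real (card (interior (dilate d P) \<inter> int_lattice)) - (?N + 1) * real (card (facets K)) / T"
      by simp
    then have "b * real d ^ ?N \<le> (1 / 2) ^ ((?N + 1) * T) *
        (real (card (interior (dilate d P) \<inter> int_lattice)) - (?N + 1) * real (card (facets K)) / T)"
      unfolding b_def mult.assoc by (intro mult_left_mono) auto
    also note expectation_ge[OF convex T(1)]
    finally show ?thesis .
  qed
  have E_lower: "b * real d ^ ?N \<le> ?E d" if "d \<ge> 1" "d \<ge> d0" for d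
    unfolding expected_b0_def
    by (rule expectation_pair_pmf_ge[where B = "CARD(bit ^ 'n) * A * real d ^ ?N"])
       (use upper[OF that(1)] lower[OF that] in auto)
  have E_upper: "?E d \<le> CARD(bit ^ 'n) * A * real d ^ ?N" if "d \<ge> 1" for d
    unfolding expected_b0_def
    by (rule measure_pmf.integral_le_const)
       (use upper[OF that] in \<open>auto simp: AE_measure_pmf_iff
          intro!: measure_pmf.integrable_const_bound[where B = "CARD(bit ^ 'n) * A * real d ^ ?N"]\<close>)
  show ?thesis
    unfolding assms(1)[symmetric]
  proof (rule bigthetaI)
    have nonneg: "?E d \<ge> 0" for d
      unfolding expected_b0_def by (rule Bochner_Integration.integral_nonneg) auto
    have "\<forall>\<^sub>F d in at_top. norm (?E d) \<le> CARD(bit ^ 'n) * A * norm (real d ^ ?N)"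
      using eventually_ge_at_top[of 1] by eventually_elim (use nonneg E_upper in simp)
    then show "?E \<in> O(\<lambda>d. real d ^ ?N)" by (rule bigoI)
    have "\<forall>\<^sub>F d in at_top. norm (?E d) \<ge> b * norm (real d ^ ?N)"
      using eventually_ge_at_top[of "max 1 d0"]
      by eventually_elim (use nonneg E_lower in simp)
    then show "?E \<in> \<Omega>(\<lambda>d. real d ^ ?N)" using b by (rule landau_omega.bigI[rotated])
  qed
qed

end
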